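(* Let $k$ be a field of characteristic $0$. For any integer $n\ge4$, with $G=\mathrm{GL}_{n/k}$, there exist $w,w'\in\mathcal S_n$ with $w'\preceq w$ such that $(w',w)$ is a bad pair and $$\dim\big(\widetilde X_w\cap\widetilde V_{w'}\big)<\dim\big(\widetilde V_{w'}\cap q^{-1}(\mathfrak t^{ww'^{-1}}+\mathfrak u)\big).$$ In particular, the equality $\widetilde V_{w'}\cap\widetilde X_w=\widetilde V_{w'}\cap q^{-1}(\mathfrak t^{ww'^{-1}}+\mathfrak u)$ does not hold for all $w'\preceq w$.
   Context: $B$, $T$, $U$ are the subgroups of $G$ of upper triangular, diagonal and unipotent upper triangular matrices, with Lie algebras $\mathfrak b,\mathfrak t,\mathfrak u$; $\mathfrak g$ is the Lie algebra of $G$. The Weyl group is $W=\mathcal S_n$ (permutation matrices, $we_i=e_{w(i)}$) with Bruhat order $\preceq$; $\mathfrak t^{v}$ is the subspace of $\mathfrak t$ fixed by $\mathrm{Ad}(v)$. All intersections, preimages and closures are taken with reduced structure. $G\times^B\mathfrak b$ is the quotient of $G\times\mathfrak b$ by $(g,\psi)b=(gb,\mathrm{Ad}(b^{-1})\psi)$; $q(g,\psi)=\mathrm{Ad}(g)\psi\in\mathfrak g$; $\widetilde\pi(g,\psi)=gB\in G/B$; $\widetilde X=q^{-1}(\mathfrak b)$; $\widetilde V_w=\widetilde X\cap\widetilde\pi^{-1}(BwB/B)$; $\widetilde X_w$ is the Zariski closure of $\widetilde V_w$ in $\widetilde X$. Let $\Phi=\{e_i-e_j:i\ne j\}\subset\mathbb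 Q^n$ with simple roots $e_i-e_{i+1}$, $s_{e_i-e_j}=(i,j)$, and $\Phi_v=\Phi\cap\operatorname{im}(v-\mathrm{id})$ for $v\in\mathcal S_n$. For $w_1\preceq w_2$, $(w_1,w_2)$ is a good pair if there is a (possibly empty) sequence $(\alpha_1,\dots,\alpha_r)$ in $\Phi_{w_1w_2^{-1}}$ with $w_2=s_{\alpha_r}\cdots s_{\alpha_1}w_1$ and $s_{\alpha_i}\cdots s_{\alpha_1}w_1\succ s_{\alpha_{i-1}}\cdots s_{\alpha_1}w_1$ for each $i$; otherwise it is a bad pair. *)

theory Defs
  imports
    "HOL-Analysis.Abstract_Topology"
    "HOL-Library.Extended_Real"
    "HOL-Combinatorics.Permutations"
    "HOL-Algebra.Algebraic_Closure_Type"
    "Jordan_Normal_Form.Gauss_Jordan_Elimination"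
begin

text \<open>
  A reduced scheme of finite type over the field \<open>k\<close> is represented by its set of points over
  the algebraic closure of \<open>k\<close>, endowed with the Zariski topology over \<open>k\<close>: closed
  sets are cut out by polynomials with coefficients in \<open>k\<close>.  Sending a geometric point to the
  closed point below it identifies the lattice of closed subsets of this space with that of the
  scheme, so closures, irreducibility and dimension are those of the scheme; reduced intersections
  and preimages become intersections and preimages of sets of points.  Indices run over \<open>{..<n}\<close>, not
  \<open>{1..n}\<close>.
\<close>


section \<open>Permutations, roots and the Bruhat order\<close>

text \<open>The matrix of \<open>w\<close>, sending the basis vector \<open>e j\<close> to \<open>e (w j)\<close>.\<close>

definition perm_mat :: "nat \<Rightarrow> (nat \<Rightarrow> nat) \<Rightarrow> 'a::semiring_1 mat" where
  "perm_mat n w = mat n n (\<lambda>(i, j). if i = w j then 1 else 0)"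

definition inversions :: "nat \<Rightarrow> (nat \<Rightarrow> nat) \<Rightarrow> (nat \<times> nat) set" where
  "inversions n w = {(i, j). i < j \<and> j < n \<and> w j < w i}"

text \<open>The Coxeter length of a permutation is its number of inversions.\<close>

definition perm_length :: "nat \<Rightarrow> (nat \<Rightarrow> nat) \<Rightarrow> nat" where
  "perm_length n w = card (inversions n w)"

definition bruhat_step :: "nat \<Rightarrow> (nat \<Rightarrow> nat) \<Rightarrow> (nat \<Rightarrow> nat) \<Rightarrow> bool" where
  "bruhat_step n u v \<longleftrightarrow>
     u permutes {..<n} \<and>
     (\<exists>i<n. \<exists>j<n. i \<noteq> j \<and> v = transpose i j \<circ> u) \<and>
     perm_length n u < perm_length n v"

definition bruhat_le :: "nat \<Rightarrow> (nat \<Rightarrow> nat) \<Rightarrow> (nat \<Rightarrow> nat) \<Rightarrow> bool" where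
  "bruhat_le n = (bruhat_step n)\<^sup>*\<^sup>*"

definition bruhat_less :: "nat \<Rightarrow> (nat \<Rightarrow> nat) \<Rightarrow> (nat \<Rightarrow> nat) \<Rightarrow> bool" where
  "bruhat_less n u v \<longleftrightarrow> bruhat_le n u v \<and> u \<noteq> v"

definition roots :: "nat \<Rightarrow> rat vec set" where
  "roots n = {unit_vec n i - unit_vec n j | i j. i < n \<and> j < n \<and> i \<noteq> j}"

definition root_reflection :: "nat \<Rightarrow> rat vec \<Rightarrow> nat \<Rightarrow> nat" where
  "root_reflection n \<alpha> =
     (THE s. \<exists>i<n. \<exists>j<n. i \<noteq> j \<and> \<alpha> = unit_vec n i - unit_vec n j \<and> s = transpose i j)"

definition roots_of_perm :: "nat \<Rightarrow> (nat \<Rightarrow> nat) \<Rightarrow> rat vec set" where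
  "roots_of_perm n v = roots n \<inter> (\<lambda>x. perm_mat n v *\<^sub>v x - x) ` carrier_vec n"

text \<open>\<open>apply_reflections n [\<alpha>\<^sub>1, \<dots>, \<alpha>\<^sub>r] w\<close> is
  \<open>s\<^bsub>\<alpha>r\<^esub> \<dots> s\<^bsub>\<alpha>1\<^esub> w\<close>.\<close>

definition apply_reflections :: "nat \<Rightarrow> rat vec list \<Rightarrow> (nat \<Rightarrow> nat) \<Rightarrow> nat \<Rightarrow> nat" where
  "apply_reflections n \<alpha>s w = fold (\<lambda>\<alpha> u. root_reflection n \<alpha> \<circ> u) \<alpha>s w"

definition good_pair :: "nat \<Rightarrow> (nat \<Rightarrow> nat) \<Rightarrow> (nat \<Rightarrow> nat) \<Rightarrow> bool" where
  "good_pair n w\<^sub>1 w\<^sub>2 \<longleftrightarrow>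
     bruhat_le n w\<^sub>1 w\<^sub>2 \<and>
     (\<exists>\<alpha>s. set \<alpha>s \<subseteq> roots_of_perm n (w\<^sub>1 \<circ> inv_into UNIV w\<^sub>2) \<and>
        w\<^sub>2 = apply_reflections n \<alpha>s w\<^sub>1 \<and>
        (\<forall>i<length \<alpha>s.
           bruhat_less n (apply_reflections n (take i \<alpha>s) w\<^sub>1)
                         (apply_reflections n (take (Suc i) \<alpha>s) w\<^sub>1)))"

definition bad_pair :: "nat \<Rightarrow> (nat \<Rightarrow> nat) \<Rightarrow> (nat \<Rightarrow> nat) \<Rightarrow> bool" where
  "bad_pair n w\<^sub>1 w\<^sub>2 \<longleftrightarrow> bruhat_le n w\<^sub>1 w\<^sub>2 \<and> \<not> good_pair n w\<^sub>1 w\<^sub>2"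


section \<open>Groups and Lie algebras of matrices\<close>

definition mat_inv :: "'a::field mat \<Rightarrow> 'a mat" where
  "mat_inv A = the (mat_inverse A)"

definition Ad :: "'a::field mat \<Rightarrow> 'a mat \<Rightarrow> 'a mat" where
  "Ad g \<psi> = g * \<psi> * mat_inv g"

definition GL :: "nat \<Rightarrow> 'a::field mat set" where
  "GL n = {g \<in> carrier_mat n n. invertible_mat g}"

definition Borel :: "nat \<Rightarrow> 'a::field mat set" where
  "Borel n = {g \<in> GL n. upper_triangular g}"

definition lie_b :: "nat \<Rightarrow> 'a::field mat set" where
  "lie_b n = {\<psi> \<in> carrier_mat n n. upper_triangular \<psi>}"

definition lie_t :: "nat \<Rightarrow> 'a::field mat set" where
  "lie_t n = {\<psi> \<in> carrier_mat n n. diagonal_mat \<psi>}"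

definition lie_u :: "nat \<Rightarrow> 'a::field mat set" where
  "lie_u n = {\<psi> \<in> lie_b n. \<forall>i<n. \<psi> $$ (i, i) = 0}"

definition lie_t_fixed :: "nat \<Rightarrow> (nat \<Rightarrow> nat) \<Rightarrow> 'a::field mat set" where
  "lie_t_fixed n v = {\<psi> \<in> lie_t n. Ad (perm_mat n v) \<psi> = \<psi>}"

definition lie_t_fixed_plus_u :: "nat \<Rightarrow> (nat \<Rightarrow> nat) \<Rightarrow> 'a::field mat set" where
  "lie_t_fixed_plus_u n v = {\<tau> + \<nu> | \<tau> \<nu>. \<tau> \<in> lie_t_fixed n v \<and> \<nu> \<in> lie_u n}"


section \<open>Zariski topology, quotient topology and dimension\<close>

text \<open>The \<open>k\<close>-algebra of functions on pairs of matrices that is generated by the matrix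
  entries, i.e. the polynomial functions with coefficients in \<open>k\<close>.\<close>

inductive_set poly_funs ::
    "nat \<Rightarrow> ('k::field alg_closure mat \<times> 'k alg_closure mat \<Rightarrow> 'k alg_closure) set"
  for n :: nat where
  const: "(\<lambda>_. to_ac c) \<in> poly_funs n"
| entry_fst: "i < n \<Longrightarrow> j < n \<Longrightarrow> (\<lambda>p. fst p $$ (i, j)) \<in> poly_funs n"
| entry_snd: "i < n \<Longrightarrow> j < n \<Longrightarrow> (\<lambda>p. snd p $$ (i, j)) \<in> poly_funs n"
| add: "f \<in> poly_funs n \<Longrightarrow> h \<in> poly_funs n \<Longrightarrow> (\<lambda>p. f p + h p) \<in> poly_funs n"
| mult: "f \<in> poly_funs n \<Longrightarrow> h \<in> poly_funs n \<Longrightarrow> (\<lambda>p. f p * h p) \<in> poly_funs n"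

text \<open>The inverse of the determinant need not be added to the coordinate functions, as
  \<open>f / det\<^sup>m\<close> and \<open>f\<close> have the same zeros.\<close>

definition zariski_GL_b ::
    "nat \<Rightarrow> ('k::field alg_closure mat \<times> 'k alg_closure mat) topology" where
  "zariski_GL_b n =
     topology_generated_by ((\<lambda>f. {p \<in> GL n \<times> lie_b n. f p \<noteq> 0}) ` poly_funs n)"

definition quotient_topology :: "'a topology \<Rightarrow> ('a \<Rightarrow> 'b) \<Rightarrow> 'b topology" where
  "quotient_topology Y f =
     topology (\<lambda>U. U \<subseteq> f ` topspace Y \<and> openin Y {x \<in> topspace Y. f x \<in> U})"

lemma openin_quotient_topology:
  "openin (quotient_topology Y f) U \<longleftrightarrow>
     U \<subseteq> f ` topspace Y \<and> openin Y {x \<in> topspace Y. f x \<in> U}"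
proof -
  have "istopology (\<lambda>U. U \<subseteq> f ` topspace Y \<and> openin Y {x \<in> topspace Y. f x \<in> U})"
    unfolding istopology_def
  proof (intro conjI allI impI)
    fix S T
    assume "S \<subseteq> f ` topspace Y \<and> openin Y {x \<in> topspace Y. f x \<in> S}"
      and "T \<subseteq> f ` topspace Y \<and> openin Y {x \<in> topspace Y. f x \<in> T}"
    moreover have "{x \<in> topspace Y. f x \<in> S \<inter> T} =
        {x \<in> topspace Y. f x \<in> S} \<inter> {x \<in> topspace Y. f x \<in> T}" by auto
    ultimately show "openin Y {x \<in> topspace Y. f x \<in> S \<inter> T}" and "S \<inter> T \<subseteq> f ` topspace Y"
      by auto
  next
    fix \<K>
    assume *: "\<forall>S\<in>\<K>. S \<subseteq> f ` topspace Y \<and> openin Y {x \<in> topspace Y. f x \<in> S}"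
    have "{x \<in> topspace Y. f x \<in> \<Union>\<K>} = (\<Union>S\<in>\<K>. {x \<in> topspace Y. f x \<in> S})" by auto
    with * show "openin Y {x \<in> topspace Y. f x \<in> \<Union>\<K>}" by auto
    from * show "\<Union>\<K> \<subseteq> f ` topspace Y" by blast
  qed
  then show ?thesis by (simp add: quotient_topology_def topology_inverse')
qed

lemma topspace_quotient_topology: "topspace (quotient_topology Y f) = f ` topspace Y"
proof
  show "topspace (quotient_topology Y f) \<subseteq> f ` topspace Y"
    using openin_topspace[of "quotient_topology Y f"] unfolding openin_quotient_topology by simp
  have "{x \<in> topspace Y. f x \<in> f ` topspace Y} = topspace Y" by auto
  then have "openin (quotient_topology Y f) (f ` topspace Y)"
    by (simp add: openin_quotient_topology)
  then show "f ` topspace Y \<subseteq> topspace (quotient_topology Y f)" by (rule openin_subset)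
qed

lemma quotient_map_quotient_topology: "quotient_map Y (quotient_topology Y f) f"
  unfolding quotient_map_def
  by (auto simp: topspace_quotient_topology openin_quotient_topology)

definition irreducible_in :: "'a topology \<Rightarrow> 'a set \<Rightarrow> bool" where
  "irreducible_in Y S \<longleftrightarrow>
     S \<subseteq> topspace Y \<and> S \<noteq> {} \<and>
     (\<forall>A B. closedin Y A \<longrightarrow> closedin Y B \<longrightarrow> S \<subseteq> A \<union> B \<longrightarrow> S \<subseteq> A \<or> S \<subseteq> B)"

text \<open>Krull dimension, with values in the extended reals; the empty space has dimension
  \<open>-\<infinity>\<close>.\<close>

definition krull_dim :: "'a topology \<Rightarrow> ereal" where
  "krull_dim Y = Sup {ereal (real m) | m. \<exists>Z.
     (\<forall>i\<le>m. closedin Y (Z i) \<and> irreducible_in Y (Z i)) \<and> (\<forall>i<m. Z i \<subset> Z (Suc i))}"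


section \<open>The quotient of \<open>GL n \<times> lie_b n\<close> by the Borel group, and its subvarieties\<close>

text \<open>A point of the quotient of \<open>GL n \<times> lie_b n\<close> by the right action of the Borel group is
  an orbit of this action.\<close>

type_synonym 'k pt = "('k alg_closure mat \<times> 'k alg_closure mat) set"

definition B_orbit ::
    "nat \<Rightarrow> 'k::field alg_closure mat \<times> 'k alg_closure mat \<Rightarrow> 'k pt" where
  "B_orbit n = (\<lambda>(g, \<psi>). (\<lambda>b. (g * b, Ad (mat_inv b) \<psi>)) ` Borel n)"

definition G_times_B_b :: "nat \<Rightarrow> 'k::field pt topology" where
  "G_times_B_b n = quotient_topology (zariski_GL_b n) (B_orbit n)"

definition coset_B :: "nat \<Rightarrow> 'a::field mat \<Rightarrow> 'a mat set" where
  "coset_B n g = (\<lambda>b. g * b) ` Borel n"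

text \<open>Both maps below descend from pairs to orbits, see \<open>q_map_B_orbit\<close> and
  \<open>pi_map_B_orbit\<close>.\<close>

definition q_map :: "nat \<Rightarrow> 'k::field pt \<Rightarrow> 'k alg_closure mat" where
  "q_map n x = the_elem ((\<lambda>(g, \<psi>). Ad g \<psi>) ` x)"

definition pi_map :: "nat \<Rightarrow> 'k::field pt \<Rightarrow> 'k alg_closure mat set" where
  "pi_map n x = the_elem ((\<lambda>(g, \<psi>). coset_B n g) ` x)"

definition q_preimage :: "nat \<Rightarrow> 'k::field alg_closure mat set \<Rightarrow> 'k pt set" where
  "q_preimage n S = {x \<in> topspace (G_times_B_b n). q_map n x \<in> S}"

definition Bruhat_cell :: "nat \<Rightarrow> (nat \<Rightarrow> nat) \<Rightarrow> 'a::field mat set set" where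
  "Bruhat_cell n w =
     {coset_B n (b * perm_mat n w * c) | b c. b \<in> Borel n \<and> c \<in> Borel n}"

definition X_tilde :: "nat \<Rightarrow> 'k::field pt set" where
  "X_tilde n = q_preimage n (lie_b n)"

definition V_tilde :: "nat \<Rightarrow> (nat \<Rightarrow> nat) \<Rightarrow> 'k::field pt set" where
  "V_tilde n w = {x \<in> X_tilde n. pi_map n x \<in> Bruhat_cell n w}"

definition X_tilde_cell :: "nat \<Rightarrow> (nat \<Rightarrow> nat) \<Rightarrow> 'k::field pt set" where
  "X_tilde_cell n w = subtopology (G_times_B_b n) (X_tilde n) closure_of V_tilde n w"

definition dim_of :: "nat \<Rightarrow> 'k::field pt set \<Rightarrow> ereal" where
  "dim_of n S = krull_dim (subtopology (G_times_B_b n) S)"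


section \<open>The two maps are well defined\<close>

lemma mat_inv_props:
  assumes "g \<in> GL n"
  shows "mat_inv g \<in> carrier_mat n n" "g * mat_inv g = 1\<^sub>m n" "mat_inv g * g = 1\<^sub>m n"
proof -
  from assms have g: "g \<in> carrier_mat n n" and "invertible_mat g" by (auto simp: GL_def)
  then obtain h where h: "g * h = 1\<^sub>m n" "h * g = 1\<^sub>m (dim_row h)"
    by (auto simp: invertible_mat_def inverts_mat_def)
  from h(1) have "dim_col h = n" by (metis index_mult_mat(3) index_one_mat(3))
  moreover from h(2) g have "dim_row h = n"
    by (metis carrier_matD(2) index_mult_mat(3) index_one_mat(3))
  ultimately have "h \<in> carrier_mat n n" by auto
  with g h have "g \<in> Units (ring_mat TYPE('a) n ())"
    by (auto simp: Units_def ring_mat_simps)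
  with mat_inverse(1)[OF g, of "()"] obtain B where "mat_inverse g = Some B" by blast
  with mat_inverse(2)[OF g this]
  show "mat_inv g \<in> carrier_mat n n" "g * mat_inv g = 1\<^sub>m n" "mat_inv g * g = 1\<^sub>m n"
    by (auto simp: mat_inv_def)
qed

lemma mat_inv_unique:
  assumes "g \<in> GL n" "h \<in> carrier_mat n n" "g * h = 1\<^sub>m n"
  shows "mat_inv g = h"
proof -
  have g: "g \<in> carrier_mat n n" using assms(1) by (simp add: GL_def)
  have "mat_inv g = mat_inv g * (g * h)"
    using mat_inv_props(1)[OF assms(1)] assms(3) by simp
  also have "\<dots> = (mat_inv g * g) * h"
    using assoc_mult_mat[OF mat_inv_props(1)[OF assms(1)] g assms(2)] by simp
  also have "\<dots> = h" using mat_inv_props(3)[OF assms(1)] assms(2) by simp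
  finally show ?thesis .
qed

lemma GL_I:
  assumes "g \<in> carrier_mat n n" "h \<in> carrier_mat n n" "g * h = 1\<^sub>m n" "h * g = 1\<^sub>m n"
  shows "g \<in> GL n"
  using assms by (auto simp: GL_def invertible_mat_def inverts_mat_def)

lemma GL_mult:
  assumes "g \<in> GL n" "h \<in> GL n"
  shows "g * h \<in> GL n" "mat_inv (g * h) = mat_inv h * mat_inv g"
proof -
  note gi = mat_inv_props[OF assms(1)] and hi = mat_inv_props[OF assms(2)]
  have g: "g \<in> carrier_mat n n" and h: "h \<in> carrier_mat n n" using assms by (auto simp: GL_def)
  have gh: "g * h \<in> carrier_mat n n" and k: "mat_inv h * mat_inv g \<in> carrier_mat n n"
    using g h gi hi by auto
  have "g * h * (mat_inv h * mat_inv g) = g * (h * mat_inv h) * mat_inv g"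
    using g h gi(1) hi(1) by (simp add: assoc_mult_mat[of _ n n _ n _ n] mult_carrier_mat[of _ n n])
  then have 1: "g * h * (mat_inv h * mat_inv g) = 1\<^sub>m n" using g gi hi by simp
  have "mat_inv h * mat_inv g * (g * h) = mat_inv h * (mat_inv g * g) * h"
    using g h gi(1) hi(1) by (simp add: assoc_mult_mat[of _ n n _ n _ n] mult_carrier_mat[of _ n n])
  then have 2: "mat_inv h * mat_inv g * (g * h) = 1\<^sub>m n" using h gi hi by simp
  show *: "g * h \<in> GL n"
    by (rule GL_I[OF gh k 1 2])
  show "mat_inv (g * h) = mat_inv h * mat_inv g" by (rule mat_inv_unique[OF * k 1])
qed

lemma GL_mat_inv:
  assumes "g \<in> GL n"
  shows "mat_inv g \<in> GL n" "mat_inv (mat_inv g) = g"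
proof -
  note gi = mat_inv_props[OF assms]
  have g: "g \<in> carrier_mat n n" using assms by (auto simp: GL_def)
  show *: "mat_inv g \<in> GL n"
    by (rule GL_I[OF gi(1) g gi(3,2)])
  show "mat_inv (mat_inv g) = g" by (rule mat_inv_unique[OF * g gi(3)])
qed

lemma Ad_mult:
  assumes "g \<in> GL n" "h \<in> GL n" "\<psi> \<in> carrier_mat n n"
  shows "Ad (g * h) \<psi> = Ad g (Ad h \<psi>)"
proof -
  have c: "g \<in> carrier_mat n n" "h \<in> carrier_mat n n"
    "mat_inv g \<in> carrier_mat n n" "mat_inv h \<in> carrier_mat n n"
    using assms mat_inv_props(1) by (auto simp: GL_def)
  show ?thesis
    unfolding Ad_def GL_mult(2)[OF assms(1,2)] using c assms(3)
    by (simp add: assoc_mult_mat[of _ n n _ n _ n] mult_carrier_mat[of _ n n])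
qed

lemma Borel_mat_inv:
  assumes "b \<in> Borel n"
  shows "mat_inv b \<in> Borel n"
proof -
  have bG: "b \<in> GL n" and ut: "upper_triangular b" using assms by (auto simp: Borel_def)
  have b: "b \<in> carrier_mat n n" using bG by (auto simp: GL_def)
  define c where "c = mat_inv b"
  have c: "c \<in> carrier_mat n n" and cb: "c * b = 1\<^sub>m n"
    using mat_inv_props[OF bG] by (auto simp: c_def)
  have "\<forall>i<n. j < i \<longrightarrow> c $$ (i, j) = 0" for j
  proof (induction j rule: less_induct)
    case (less j)
    have key: "c $$ (i, j) * b $$ (j, j) = 1\<^sub>m n $$ (i, j)" if "i < n" "j \<le> i" for i
    proof -
      have "j < n" using that by simp
      have "1\<^sub>m n $$ (i, j) = (c * b) $$ (i, j)" by (simp add: cb)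
      also have "\<dots> = (\<Sum>k = 0..<n. c $$ (i, k) * b $$ (k, j))"
        using b c that \<open>j < n\<close> by (simp add: scalar_prod_def)
      also have "\<dots> = (\<Sum>k \<in> {j}. c $$ (i, k) * b $$ (k, j))"
      proof (rule sum.mono_neutral_right)
        show "\<forall>k\<in>{0..<n} - {j}. c $$ (i, k) * b $$ (k, j) = 0"
        proof
          fix k assume k: "k \<in> {0..<n} - {j}"
          show "c $$ (i, k) * b $$ (k, j) = 0"
          proof (cases "k < j")
            case True
            then show ?thesis using less.IH[of k] that by simp
          next
            case False
            then have "j < k" "k < dim_row b" using k b by auto
            then show ?thesis using ut by (simp add: upper_triangular_def)
          qed
        qed
      qed (use \<open>j < n\<close> in auto)
      finally show ?thesis by simp
    qed
    show ?case
    proof (intro allI impI)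
      fix i assume i: "i < n" "j < i"
      have "b $$ (j, j) \<noteq> 0" using key[of j] i by auto
      then show "c $$ (i, j) = 0" using key[of i] i by simp
    qed
  qed
  then have "upper_triangular c" using c by (auto simp: upper_triangular_def)
  then show ?thesis using GL_mat_inv(1)[OF bG] by (simp add: Borel_def c_def)
qed

lemma Borel_mult:
  assumes "b \<in> Borel n" "c \<in> Borel n"
  shows "b * c \<in> Borel n"
proof -
  have b: "b \<in> GL n" "upper_triangular b" "b \<in> carrier_mat n n"
    and c: "c \<in> GL n" "upper_triangular c" "c \<in> carrier_mat n n"
    using assms by (auto simp: Borel_def GL_def)
  have "(b * c) $$ (i, j) = 0" if "i < n" "j < i" for i j
  proof -
    have "(b * c) $$ (i, j) = (\<Sum>k = 0..<n. b $$ (i, k) * c $$ (k, j))"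
      using b c that by (simp add: scalar_prod_def)
    also have "\<dots> = 0"
    proof (rule sum.neutral, rule ballI)
      fix k assume "k \<in> {0..<n}"
      then show "b $$ (i, k) * c $$ (k, j) = 0"
        using b c that by (cases "k < i") (auto simp: upper_triangular_def)
    qed
    finally show ?thesis .
  qed
  then have "upper_triangular (b * c)" using b c by (auto simp: upper_triangular_def)
  then show ?thesis using GL_mult(1)[OF b(1) c(1)] by (simp add: Borel_def)
qed

lemma one_Borel: "1\<^sub>m n \<in> Borel n"
proof -
  have "(1\<^sub>m n :: 'a mat) \<in> GL n"
    by (rule GL_I[of _ _ "1\<^sub>m n"]) auto
  then show ?thesis by (auto simp: Borel_def upper_triangular_def)
qed

lemma coset_B_mult:
  assumes "g \<in> GL n" "b \<in> Borel n"
  shows "coset_B n (g * b) = coset_B n g"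
proof -
  have g: "g \<in> carrier_mat n n" and b: "b \<in> GL n" "b \<in> carrier_mat n n"
    using assms by (auto simp: Borel_def GL_def)
  have B: "c \<in> carrier_mat n n" if "c \<in> Borel n" for c :: "'a mat"
    using that by (auto simp: Borel_def GL_def)
  show ?thesis
  proof
    show "coset_B n (g * b) \<subseteq> coset_B n g"
      unfolding coset_B_def using assms(2) Borel_mult B g b(2)
      by (auto simp: assoc_mult_mat[of _ n n _ n _ n])
    show "coset_B n g \<subseteq> coset_B n (g * b)"
    proof
      fix x assume "x \<in> coset_B n g"
      then obtain c where c: "c \<in> Borel n" "x = g * c" by (auto simp: coset_B_def)
      note bi = mat_inv_props[OF b(1)]
      have "g * b * (mat_inv b * c) = g * (b * mat_inv b) * c"
        using g b(2) bi(1) B[OF c(1)] by (simp add: assoc_mult_mat[of _ n n _ n _ n] mult_carrier_mat[of _ n n])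
      then have "x = g * b * (mat_inv b * c)" using bi(2) g c(2) by simp
      moreover have "mat_inv b * c \<in> Borel n"
        using Borel_mat_inv[OF assms(2)] Borel_mult c(1) by blast
      ultimately show "x \<in> coset_B n (g * b)" by (auto simp: coset_B_def)
    qed
  qed
qed

lemma q_map_B_orbit:
  fixes g :: "'k::field alg_closure mat"
  assumes "g \<in> GL n" "\<psi> \<in> lie_b n"
  shows "q_map n (B_orbit n (g, \<psi>)) = Ad g \<psi>"
proof -
  have \<psi>: "\<psi> \<in> carrier_mat n n" using assms by (simp add: lie_b_def)
  have "Ad (g * b) (Ad (mat_inv b) \<psi>) = Ad g \<psi>" if "b \<in> Borel n" for b
  proof -
    have b: "b \<in> GL n" "b \<in> carrier_mat n n" using that by (auto simp: Borel_def GL_def)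
    note bi = GL_mat_inv[OF b(1)] and bp = mat_inv_props[OF b(1)]
    have g: "g \<in> carrier_mat n n" using assms by (simp add: GL_def)
    have "Ad (g * b) (Ad (mat_inv b) \<psi>) = Ad (g * b * mat_inv b) \<psi>"
      using Ad_mult[OF GL_mult(1)[OF assms(1) b(1)] bi(1) \<psi>] by simp
    also have "g * b * mat_inv b = g"
      using assoc_mult_mat[OF g b(2) bp(1)] bp(2) g by simp
    finally show ?thesis .
  qed
  then have "(\<lambda>(g, \<psi>). Ad g \<psi>) ` B_orbit n (g, \<psi>) = (\<lambda>_. Ad g \<psi>) ` (Borel n :: 'k alg_closure mat set)"
    by (simp add: B_orbit_def image_image)
  then have "(\<lambda>(g, \<psi>). Ad g \<psi>) ` B_orbit n (g, \<psi>) = {Ad g \<psi>}"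
    using image_constant[OF one_Borel] by simp
  then show ?thesis by (simp add: q_map_def)
qed

lemma pi_map_B_orbit:
  fixes g :: "'k::field alg_closure mat"
  assumes "g \<in> GL n"
  shows "pi_map n (B_orbit n (g, \<psi>)) = coset_B n g"
proof -
  have "(\<lambda>(g, \<psi>). coset_B n g) ` B_orbit n (g, \<psi>) = (\<lambda>_. coset_B n g) ` (Borel n :: 'k alg_closure mat set)"
    using coset_B_mult[OF assms] by (simp add: B_orbit_def image_image)
  then have "(\<lambda>(g, \<psi>). coset_B n g) ` B_orbit n (g, \<psi>) = {coset_B n g}"
    using image_constant[OF one_Borel] by simp
  then show ?thesis by (simp add: pi_map_def)
qed

end

theory Submission
  imports
    Defs
    "Jordan_Normal_Form.Determinant"
    "HOL-Library.Function_Algebras"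
begin

text \<open>
  Take \<open>w\<close> to be the transposition of 0 and 3 and \<open>w'\<close> that of 1 and 2.  The pair is bad because the
  only reflections available are \<open>w\<close> and \<open>w'\<close> themselves, and going up from \<open>w'\<close> they lead to
  \<open>w w'\<close>, which is too long.  Let \<open>C\<close> be the subset of \<open>V_tilde n w'\<close> over
  \<open>t\<^bsup>w w'\<^esup> + u\<close>.  Comparing the diagonals of \<open>\<psi>\<close> and \<open>Ad(g) \<psi>\<close> shows
  that the closure of \<open>V_tilde n w\<close> meets \<open>V_tilde n w'\<close> inside \<open>C\<close>.  The polynomial
  \<open>(g \<psi>)\<^sub>2\<^sub>1 - \<psi>\<^sub>0\<^sub>0 g\<^sub>2\<^sub>1\<close> vanishes on that closure, but not on all of \<open>C\<close>: on \<open>C\<close> the eigenvalue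
  shared by the positions 1 and 2 may differ from the one shared by 0 and 3, and in that case
  the two flags would have to stay in constant relative position on the generalized eigenspace of
  the former.  Since \<open>C\<close> is irreducible and of finite dimension, the dimension drops.

  The quotient map by the Borel group is open with irreducible fibers, so chains of irreducible
  closed subsets lift to \<open>GL n \<times> lie_b n\<close>, where they are bounded by counting monomials.
\<close>

section \<open>Polynomial functions\<close>

text \<open>Only the indices 0 to 3 move. In one-line notation \<open>w\<close> is 3120, of length
  5, and \<open>w'\<close> is 0213, of length 1. The extra equation has its origin in the inversion
  (0, 1) of \<open>w\<close>: conjugation by \<open>w\<close> moves the entry (0, 1) of Ad(c) \<psi>
  to (3, 1), below the diagonal, so this entry vanishes over the cell of \<open>w\<close>. It is no
  inversion of \<open>w'\<close>, so nothing forces the same over the cell of \<open>w'\<close>.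

  Two obstacles shape the rest. Points live over the algebraic closure while closed sets are cut out
  over \<open>k\<close>, so every argument that moves a point along its orbit inside an open set has
  to find a \<open>k\<close>-rational group element; characteristic 0 enters through the infinity of
  \<open>k\<close>. Moreover the dimension is a supremum over chains, so adding one member to a
  chain proves a strict inequality only once that supremum is known to be finite. Any finite bound
  will do, and 2 n^2, the number of matrix entries of a pair, comes out of a count of monomials
  without transcendence degrees or dimension theory.\<close>

locale function_algebra =
  fixes S :: "('x \<Rightarrow> 'a::comm_ring_1) set"
  assumes zero: "(\<lambda>_. 0) \<in> S"
    and one: "(\<lambda>_. 1) \<in> S"
    and minus_one: "(\<lambda>_. - 1) \<in> S"
    and add: "f \<in> S \<Longrightarrow> h \<in> S \<Longrightarrow> (\<lambda>x. f x + h x) \<in> S"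
    and mult: "f \<in> S \<Longrightarrow> h \<in> S \<Longrightarrow> (\<lambda>x. f x * h x) \<in> S"
begin

lemma diff:
  assumes "f \<in> S" "h \<in> S"
  shows "(\<lambda>x. f x - h x) \<in> S"
  using add[OF assms(1) mult[OF minus_one assms(2)]] by simp

lemma sum: "(\<And>i. i \<in> I \<Longrightarrow> f i \<in> S) \<Longrightarrow> (\<lambda>x. \<Sum>i\<in>I. f i x) \<in> S"
  by (induction I rule: infinite_finite_induct) (auto intro: zero add)

lemma prod: "(\<And>i. i \<in> I \<Longrightarrow> f i \<in> S) \<Longrightarrow> (\<lambda>x. \<Prod>i\<in>I. f i x) \<in> S"
  by (induction I rule: infinite_finite_induct) (auto intro: one mult)

lemma power: "f \<in> S \<Longrightarrow> (\<lambda>x. f x ^ m) \<in> S"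
  by (induction m) (auto intro: one mult)

lemma signof: "(\<lambda>_. signof p) \<in> S"
  by (auto simp: sign_def intro: one minus_one)

lemma det:
  assumes "\<And>x. M x \<in> carrier_mat m m"
    and "\<And>i j. i < m \<Longrightarrow> j < m \<Longrightarrow> (\<lambda>x. M x $$ (i, j)) \<in> S"
  shows "(\<lambda>x. det (M x)) \<in> S"
  unfolding det_def'[OF assms(1)]
proof (intro sum mult signof prod assms(2))
  fix p i
  assume "p \<in> {p. p permutes {0..<m}}" and "i \<in> {0..<m}"
  then show "i < m" "p i < m"
    by (auto dest: permutes_in_image)
qed

lemma adj_mat:
  assumes M: "\<And>x. M x \<in> carrier_mat m m"
    and "\<And>i j. i < m \<Longrightarrow> j < m \<Longrightarrow> (\<lambda>x. M x $$ (i, j)) \<in> S"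
    and "i < m" "j < m"
  shows "(\<lambda>x. adj_mat (M x) $$ (i, j)) \<in> S"
proof -
  have dim: "dim_row (M x) = m" "dim_col (M x) = m" for x
    using M[of x] by auto
  have "(\<lambda>x. (- 1) ^ (j + i) * det (mat_delete (M x) j i)) \<in> S"
  proof (rule mult[OF power[OF minus_one] det])
    show "mat_delete (M x) j i \<in> carrier_mat (m - 1) (m - 1)" for x
      by (rule mat_delete_carrier[OF M])
    show "(\<lambda>x. mat_delete (M x) j i $$ (i', j')) \<in> S" if "i' < m - 1" "j' < m - 1" for i' j'
      using that by (auto simp: mat_delete_def dim intro!: assms(2))
  qed
  then show ?thesis
    using assms(3,4) by (simp add: adj_mat_def cofactor_def dim)
qed

lemma mult_mat:
  assumes M: "\<And>x. M x \<in> carrier_mat m m"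
    and N: "\<And>x. N x \<in> carrier_mat m m"
    and "\<And>i j. i < m \<Longrightarrow> j < m \<Longrightarrow> (\<lambda>x. M x $$ (i, j)) \<in> S"
    and "\<And>i j. i < m \<Longrightarrow> j < m \<Longrightarrow> (\<lambda>x. N x $$ (i, j)) \<in> S"
    and "i < m" "j < m"
  shows "(\<lambda>x. (M x * N x) $$ (i, j)) \<in> S"
proof -
  have dim: "dim_row (M x) = m" "dim_col (M x) = m" "dim_row (N x) = m" "dim_col (N x) = m" for x
    using M[of x] N[of x] by auto
  show ?thesis
    using assms(5,6) by (auto simp: scalar_prod_def dim intro!: sum mult assms(3,4))
qed

end

text \<open>The rules for products, determinants and adjugates serve three algebras: polynomial
  functions on pairs over \<open>k\<close>, polynomials in one parameter over the closure, and, on a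
  one-point domain, the field \<open>k\<close> itself. None of them has inverses, hence the adjugate
  in place of \<open>mat_inv\<close>.\<close>

interpretation poly_funs: function_algebra "poly_funs n"
proof
  show "(\<lambda>_. 0) \<in> poly_funs n" "(\<lambda>_. 1) \<in> poly_funs n" "(\<lambda>_. - 1) \<in> poly_funs n"
    using poly_funs.const[of 0 n] poly_funs.const[of 1 n] poly_funs.const[of "- 1" n] by auto
qed (auto intro: poly_funs.add poly_funs.mult)

interpretation poly: function_algebra "range poly"
proof
  show "(\<lambda>_. 0) \<in> range poly" "(\<lambda>_. 1) \<in> range poly" "(\<lambda>_. - 1) \<in> range poly"
    by (auto intro!: range_eqI[of _ _ "[:0:]"] range_eqI[of _ _ "[:1:]"] range_eqI[of _ _ "[:-1:]"])
  fix f h :: "'a \<Rightarrow> 'a"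
  assume "f \<in> range poly" and "h \<in> range poly"
  then obtain p q where "f = poly p" "h = poly q"
    by blast
  then have "(\<lambda>x. f x + h x) = poly (p + q)" "(\<lambda>x. f x * h x) = poly (p * q)"
    by auto
  then show "(\<lambda>x. f x + h x) \<in> range poly" "(\<lambda>x. f x * h x) \<in> range poly"
    by blast+
qed

lemma range_poly_const: "(\<lambda>_. c) \<in> range poly"
  by (auto intro!: range_eqI[of _ _ "[:c:]"])

lemma range_poly_affine: "(\<lambda>t. c + t * d) \<in> range poly"
  by (auto intro!: range_eqI[of _ _ "[:c, d:]"])

lemma range_poly_nonzero:
  fixes h :: "'a::idom \<Rightarrow> 'a"
  assumes "h \<in> range poly" "h t\<^sub>0 \<noteq> 0" "infinite T"
  obtains t where "t \<in> T" "h t \<noteq> 0"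
proof -
  obtain p where p: "h = poly p"
    using assms(1) by blast
  then have "p \<noteq> 0"
    using assms(2) by auto
  then have "finite {t. h t = 0}"
    using p poly_roots_finite by auto
  then have "\<not> T \<subseteq> {t. h t = 0}"
    using assms(3) finite_subset by blast
  then show ?thesis
    using that by blast
qed

section \<open>Polynomial functions along curves and under substitution\<close>

lemma poly_funs_curve:
  assumes "f \<in> poly_funs n"
    and "\<And>i j. i < n \<Longrightarrow> j < n \<Longrightarrow> (\<lambda>t. M t $$ (i, j)) \<in> range poly"
    and "\<And>i j. i < n \<Longrightarrow> j < n \<Longrightarrow> (\<lambda>t. N t $$ (i, j)) \<in> range poly"
  shows "(\<lambda>t. f (M t, N t)) \<in> range poly"
  using assms(1)
  by induction (auto intro: range_poly_const poly.add poly.mult assms(2,3))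

lemma poly_funs_compose:
  assumes "f \<in> poly_funs n"
    and "\<And>i j. i < n \<Longrightarrow> j < n \<Longrightarrow> (\<lambda>p. M p $$ (i, j)) \<in> poly_funs n"
    and "\<And>i j. i < n \<Longrightarrow> j < n \<Longrightarrow> (\<lambda>p. N p $$ (i, j)) \<in> poly_funs n"
  shows "(\<lambda>p. f (M p, N p)) \<in> poly_funs n"
  using assms(1)
  by induction (auto intro: poly_funs.intros assms(2,3))

text \<open>Only the second matrix carries the denominator \<delta>, so a power of \<delta> clears
  it. The exponent depends on \<open>f\<close> and is found along its construction; for a sum both
  exponents are added, which gives a common denominator without comparing them.\<close>

lemma poly_funs_rational_curve:
  assumes "f \<in> poly_funs n" and \<delta>: "\<delta> \<in> range poly"
    and "\<And>i j. i < n \<Longrightarrow> j < n \<Longrightarrow> (\<lambda>t. M t $$ (i, j)) \<in> range poly"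
    and "\<And>i j. i < n \<Longrightarrow> j < n \<Longrightarrow> (\<lambda>t. N t $$ (i, j)) \<in> range poly"
    and N: "\<And>t. N t \<in> carrier_mat n n"
  shows "\<exists>m. \<exists>h\<in>range poly. \<forall>t. \<delta> t \<noteq> 0 \<longrightarrow> \<delta> t ^ m * f (M t, inverse (\<delta> t) \<cdot>\<^sub>m N t) = h t"
  using assms(1)
proof induction
  case (const c)
  show ?case
    by (rule exI[of _ 0], rule bexI[of _ "\<lambda>_. to_ac c"]) (auto intro: range_poly_const)
next
  case (entry_fst i j)
  show ?case
    by (rule exI[of _ 0], rule bexI[of _ "\<lambda>t. M t $$ (i, j)"]) (use assms(3) entry_fst in auto)
next
  case (entry_snd i j)
  have "dim_row (N t) = n" "dim_col (N t) = n" for t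
    using N[of t] by auto
  then show ?case
    by (intro exI[of _ 1] bexI[of _ "\<lambda>t. N t $$ (i, j)"])
      (use assms(4) entry_snd in \<open>auto simp: field_simps\<close>)
next
  case (add f h)
  then obtain m\<^sub>1 h\<^sub>1 m\<^sub>2 h\<^sub>2 where *: "h\<^sub>1 \<in> range poly" "h\<^sub>2 \<in> range poly"
    "\<And>t. \<delta> t \<noteq> 0 \<Longrightarrow> \<delta> t ^ m\<^sub>1 * f (M t, inverse (\<delta> t) \<cdot>\<^sub>m N t) = h\<^sub>1 t"
    "\<And>t. \<delta> t \<noteq> 0 \<Longrightarrow> \<delta> t ^ m\<^sub>2 * h (M t, inverse (\<delta> t) \<cdot>\<^sub>m N t) = h\<^sub>2 t"
    by blast
  show ?case
  proof (intro exI[of _ "m\<^sub>1 + m\<^sub>2"] bexI[of _ "\<lambda>t. \<delta> t ^ m\<^sub>2 * h\<^sub>1 t + \<delta> t ^ m\<^sub>1 * h\<^sub>2 t"] allI impI)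
    fix t
    assume "\<delta> t \<noteq> 0"
    then show "\<delta> t ^ (m\<^sub>1 + m\<^sub>2) * (f (M t, inverse (\<delta> t) \<cdot>\<^sub>m N t) + h (M t, inverse (\<delta> t) \<cdot>\<^sub>m N t))
        = \<delta> t ^ m\<^sub>2 * h\<^sub>1 t + \<delta> t ^ m\<^sub>1 * h\<^sub>2 t"
      by (simp add: *(3,4)[symmetric] power_add algebra_simps)
  qed (intro poly.add poly.mult poly.power \<delta> *(1,2))
next
  case (mult f h)
  then obtain m\<^sub>1 h\<^sub>1 m\<^sub>2 h\<^sub>2 where *: "h\<^sub>1 \<in> range poly" "h\<^sub>2 \<in> range poly"
    "\<And>t. \<delta> t \<noteq> 0 \<Longrightarrow> \<delta> t ^ m\<^sub>1 * f (M t, inverse (\<delta> t) \<cdot>\<^sub>m N t) = h\<^sub>1 t"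
    "\<And>t. \<delta> t \<noteq> 0 \<Longrightarrow> \<delta> t ^ m\<^sub>2 * h (M t, inverse (\<delta> t) \<cdot>\<^sub>m N t) = h\<^sub>2 t"
    by blast
  show ?case
  proof (intro exI[of _ "m\<^sub>1 + m\<^sub>2"] bexI[of _ "\<lambda>t. h\<^sub>1 t * h\<^sub>2 t"] allI impI)
    fix t
    assume "\<delta> t \<noteq> 0"
    then show "\<delta> t ^ (m\<^sub>1 + m\<^sub>2) * (f (M t, inverse (\<delta> t) \<cdot>\<^sub>m N t) * h (M t, inverse (\<delta> t) \<cdot>\<^sub>m N t))
        = h\<^sub>1 t * h\<^sub>2 t"
      by (simp add: *(3,4)[symmetric] power_add algebra_simps)
  qed (intro poly.mult *(1,2))
qed


section \<open>The action of the Borel group\<close>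

lemma inverse_det_adj_mat:
  fixes g :: "'a::field mat"
  assumes g: "g \<in> carrier_mat n n" and d: "det g \<noteq> 0"
  shows "inverse (det g) \<cdot>\<^sub>m adj_mat g \<in> carrier_mat n n"
    and "g * (inverse (det g) \<cdot>\<^sub>m adj_mat g) = 1\<^sub>m n"
    and "inverse (det g) \<cdot>\<^sub>m adj_mat g * g = 1\<^sub>m n"
proof -
  note adj = adj_mat[OF g]
  show "inverse (det g) \<cdot>\<^sub>m adj_mat g \<in> carrier_mat n n"
    using adj by simp
  have 1: "inverse (det g) \<cdot>\<^sub>m (det g \<cdot>\<^sub>m 1\<^sub>m n) = 1\<^sub>m n"
    using d by (intro eq_matI) auto
  show "g * (inverse (det g) \<cdot>\<^sub>m adj_mat g) = 1\<^sub>m n"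
    using mult_smult_distrib[OF g adj(1)] adj(2) 1 by simp
  show "inverse (det g) \<cdot>\<^sub>m adj_mat g * g = 1\<^sub>m n"
    using mult_smult_assoc_mat[OF adj(1) g] adj(3) 1 by simp
qed

lemma GL_iff_det: "g \<in> GL n \<longleftrightarrow> g \<in> carrier_mat n n \<and> det g \<noteq> 0"
proof (intro iffI conjI)
  assume g: "g \<in> GL n"
  then show gc: "g \<in> carrier_mat n n"
    by (simp add: GL_def)
  have "det g * det (mat_inv g) = 1"
    using det_mult[OF gc mat_inv_props(1)[OF g]] mat_inv_props(2)[OF g] by simp
  then show "det g \<noteq> 0"
    by auto
next
  assume g: "g \<in> carrier_mat n n \<and> det g \<noteq> 0"
  then show "g \<in> GL n"
    by (intro GL_I[OF _ inverse_det_adj_mat]) auto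
qed

lemma mat_inv_adj_mat: "g \<in> GL n \<Longrightarrow> mat_inv g = inverse (det g) \<cdot>\<^sub>m adj_mat g"
  by (rule mat_inv_unique) (auto simp: GL_iff_det intro: inverse_det_adj_mat)

lemma GL_carrier: "g \<in> GL n \<Longrightarrow> g \<in> carrier_mat n n"
  by (simp add: GL_def)

lemma Borel_GL: "b \<in> Borel n \<Longrightarrow> b \<in> GL n"
  by (simp add: Borel_def)

lemma Borel_carrier: "b \<in> Borel n \<Longrightarrow> b \<in> carrier_mat n n"
  by (simp add: Borel_def GL_def)

lemma lie_b_carrier: "\<psi> \<in> lie_b n \<Longrightarrow> \<psi> \<in> carrier_mat n n"
  by (simp add: lie_b_def)

lemma Borel_lie_b: "b \<in> Borel n \<Longrightarrow> b \<in> lie_b n"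
  by (simp add: Borel_def GL_def lie_b_def)

lemma Borel_iff_det: "b \<in> Borel n \<longleftrightarrow> b \<in> lie_b n \<and> det b \<noteq> 0"
  by (auto simp: Borel_def lie_b_def GL_iff_det)

lemma lie_b_mult:
  assumes "\<phi> \<in> lie_b n" "\<psi> \<in> lie_b n"
  shows "\<phi> * \<psi> \<in> lie_b n"
    and "i < n \<Longrightarrow> (\<phi> * \<psi>) $$ (i, i) = \<phi> $$ (i, i) * \<psi> $$ (i, i)"
proof -
  have c: "dim_row \<phi> = n" "dim_col \<phi> = n" "dim_row \<psi> = n" "dim_col \<psi> = n"
    and z: "\<And>i j. j < i \<Longrightarrow> i < n \<Longrightarrow> \<phi> $$ (i, j) = 0" "\<And>i j. j < i \<Longrightarrow> i < n \<Longrightarrow> \<psi> $$ (i, j) = 0"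
    using assms by (auto simp: lie_b_def)
  have "(\<phi> * \<psi>) $$ (i, j) = 0" if "j < i" "i < n" for i j
  proof -
    have "\<phi> $$ (i, k) * \<psi> $$ (k, j) = 0" if "k < n" for k
      using z[of k i] z[of j k] \<open>j < i\<close> \<open>i < n\<close> that by (cases "k < i") auto
    then have "(\<Sum>k = 0..<n. \<phi> $$ (i, k) * \<psi> $$ (k, j)) = 0"
      by (intro sum.neutral) auto
    then show ?thesis
      using that by (simp add: scalar_prod_def c)
  qed
  then show "\<phi> * \<psi> \<in> lie_b n"
    by (auto simp: lie_b_def c)
  assume i: "i < n"
  have "(\<phi> * \<psi>) $$ (i, i) = (\<Sum>k = 0..<n. \<phi> $$ (i, k) * \<psi> $$ (k, i))"
    using i by (simp add: scalar_prod_def c)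
  also have "\<dots> = (\<Sum>k\<in>{i}. \<phi> $$ (i, k) * \<psi> $$ (k, i))"
  proof (rule sum.mono_neutral_right)
    show "\<forall>k\<in>{0..<n} - {i}. \<phi> $$ (i, k) * \<psi> $$ (k, i) = 0"
    proof
      fix k
      assume "k \<in> {0..<n} - {i}"
      then show "\<phi> $$ (i, k) * \<psi> $$ (k, i) = 0"
        using z(1)[of k i] z(2)[of i k] i by (cases "k < i") auto
    qed
  qed (use i in auto)
  finally show "(\<phi> * \<psi>) $$ (i, i) = \<phi> $$ (i, i) * \<psi> $$ (i, i)"
    by simp
qed

text \<open>Taking diagonals is multiplicative on upper triangular matrices, and scalars commute, so
  conjugation by the Borel group cannot change the diagonal. This makes the diagonal an invariant of
  an orbit.\<close>

lemma Ad_Borel: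
  assumes b: "b \<in> Borel n" and \<psi>: "\<psi> \<in> lie_b n"
  shows "Ad b \<psi> \<in> lie_b n" and "i < n \<Longrightarrow> Ad b \<psi> $$ (i, i) = \<psi> $$ (i, i)"
proof -
  note B = Borel_lie_b[OF b] Borel_lie_b[OF Borel_mat_inv[OF b]]
  show "Ad b \<psi> \<in> lie_b n"
    unfolding Ad_def by (intro lie_b_mult B \<psi>)
  assume i: "i < n"
  have "b $$ (i, i) * mat_inv b $$ (i, i) = 1"
    using lie_b_mult(2)[OF B i] mat_inv_props(2)[OF Borel_GL[OF b]] i by simp
  then show "Ad b \<psi> $$ (i, i) = \<psi> $$ (i, i)"
    unfolding Ad_def
    using lie_b_mult(2)[OF lie_b_mult(1)[OF B(1) \<psi>] B(2) i] lie_b_mult(2)[OF B(1) \<psi> i]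
    by (simp add: algebra_simps)
qed

lemma Ad_carrier: "g \<in> GL n \<Longrightarrow> \<psi> \<in> carrier_mat n n \<Longrightarrow> Ad g \<psi> \<in> carrier_mat n n"
  unfolding Ad_def by (meson GL_carrier mat_inv_props(1) mult_carrier_mat)

lemma Ad_one:
  assumes "\<psi> \<in> carrier_mat n n"
  shows "Ad (1\<^sub>m n) \<psi> = \<psi>"
proof -
  have "mat_inv (1\<^sub>m n :: 'a mat) = 1\<^sub>m n"
    by (rule mat_inv_unique) (use one_Borel in \<open>auto simp: Borel_def\<close>)
  then show ?thesis
    using assms by (simp add: Ad_def)
qed

lemma Ad_mat_inv_cancel:
  assumes "g \<in> GL n" "\<psi> \<in> carrier_mat n n"
  shows "Ad g (Ad (mat_inv g) \<psi>) = \<psi>" "Ad (mat_inv g) (Ad g \<psi>) = \<psi>"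
  using Ad_mult[OF assms(1) GL_mat_inv(1)[OF assms(1)] assms(2)]
    Ad_mult[OF GL_mat_inv(1)[OF assms(1)] assms(1) assms(2)]
    mat_inv_props[OF assms(1)] Ad_one[OF assms(2)] by auto

section \<open>The right action of the Borel group on pairs, and its orbits\<close>

definition B_act :: "'a::field mat \<Rightarrow> 'a mat \<times> 'a mat \<Rightarrow> 'a mat \<times> 'a mat" where
  "B_act b x = (fst x * b, Ad (mat_inv b) (snd x))"

lemma B_orbit_B_act: "B_orbit n x = (\<lambda>b. B_act b x) ` Borel n"
  by (cases x) (simp add: B_orbit_def B_act_def)

lemma B_act_in:
  assumes "x \<in> GL n \<times> lie_b n" "b \<in> Borel n"
  shows "B_act b x \<in> GL n \<times> lie_b n"
  using assms GL_mult(1)[OF _ Borel_GL] Ad_Borel(1)[OF Borel_mat_inv] by (auto simp: B_act_def)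

lemma B_act_mult:
  assumes "x \<in> GL n \<times> lie_b n" "b \<in> Borel n" "c \<in> Borel n"
  shows "B_act c (B_act b x) = B_act (b * c) x"
proof -
  have 1: "fst x \<in> carrier_mat n n" "snd x \<in> carrier_mat n n"
    using assms(1) by (auto simp: GL_def lie_b_def)
  note bc = Borel_GL[OF assms(2)] Borel_GL[OF assms(3)]
  note bcc = GL_carrier[OF bc(1)] GL_carrier[OF bc(2)]
  show ?thesis
    unfolding B_act_def GL_mult(2)[OF bc]
    using Ad_mult[OF GL_mat_inv(1)[OF bc(2)] GL_mat_inv(1)[OF bc(1)] 1(2)]
      assoc_mult_mat[OF 1(1) bcc] by simp
qed

lemma B_act_one: "x \<in> GL n \<times> lie_b n \<Longrightarrow> B_act (1\<^sub>m n) x = x"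
proof -
  assume x: "x \<in> GL n \<times> lie_b n"
  have "mat_inv (1\<^sub>m n :: 'a mat) = 1\<^sub>m n"
    by (rule mat_inv_unique) (use one_Borel in \<open>auto simp: Borel_def\<close>)
  then show ?thesis
    using x Ad_one[of "snd x" n] by (auto simp: B_act_def GL_def lie_b_def)
qed

lemma B_orbit_B_act_eq:
  assumes x: "x \<in> GL n \<times> lie_b n" and b: "b \<in> Borel n"
  shows "B_orbit n (B_act b x) = B_orbit n x"
proof
  show "B_orbit n (B_act b x) \<subseteq> B_orbit n x"
    unfolding B_orbit_B_act using B_act_mult[OF x b] Borel_mult[OF b] by auto
  show "B_orbit n x \<subseteq> B_orbit n (B_act b x)"
  proof
    fix y
    assume "y \<in> B_orbit n x"
    then obtain c where c: "c \<in> Borel n" "y = B_act c x"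
      by (auto simp: B_orbit_B_act)
    note bi = mat_inv_props[OF Borel_GL[OF b]]
    have "b * (mat_inv b * c) = c"
      using assoc_mult_mat[OF Borel_carrier[OF b] bi(1) Borel_carrier[OF c(1)]] bi(2)
        Borel_carrier[OF c(1)] by simp
    then have "y = B_act (mat_inv b * c) (B_act b x)"
      using B_act_mult[OF x b Borel_mult[OF Borel_mat_inv[OF b] c(1)]] c(2) by simp
    then show "y \<in> B_orbit n (B_act b x)"
      using Borel_mult[OF Borel_mat_inv[OF b] c(1)] by (auto simp: B_orbit_B_act)
  qed
qed

lemma B_orbit_self: "x \<in> GL n \<times> lie_b n \<Longrightarrow> x \<in> B_orbit n x"
  unfolding B_orbit_B_act using B_act_one one_Borel by (metis image_eqI)

lemma B_orbit_eq_iff: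
  assumes "x \<in> GL n \<times> lie_b n" "y \<in> GL n \<times> lie_b n"
  shows "B_orbit n x = B_orbit n y \<longleftrightarrow> (\<exists>b\<in>Borel n. y = B_act b x)"
  using B_orbit_self[OF assms(2)] B_orbit_B_act_eq[OF assms(1)] by (auto simp: B_orbit_B_act)

text \<open>Cramer's rule turns \<open>f (B_act (b t) x)\<close> into a polynomial in \<open>t\<close> divided by a power
  of \<open>det (b t)\<close>; one further factor \<open>det (b t)\<close> makes the numerator detect invertibility.\<close>

lemma poly_funs_Borel_curve:
  assumes f: "f \<in> poly_funs n" and x: "x \<in> GL n \<times> lie_b n"
    and b: "\<And>t. b t \<in> lie_b n"
    and bp: "\<And>i j. i < n \<Longrightarrow> j < n \<Longrightarrow> (\<lambda>t. b t $$ (i, j)) \<in> range poly"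
  obtains h where "h \<in> range poly" "\<And>t. h t \<noteq> 0 \<longleftrightarrow> b t \<in> Borel n \<and> f (B_act (b t) x) \<noteq> 0"
proof -
  have bc: "b t \<in> carrier_mat n n" for t
    by (rule lie_b_carrier[OF b])
  have x1: "fst x \<in> carrier_mat n n" and x2: "snd x \<in> carrier_mat n n"
    using x by (auto simp: GL_def lie_b_def)
  define M where "M t = fst x * b t" for t
  \<comment> \<open>Up to the factor \<open>det (b t)\<close> this is \<open>snd x\<close>
    conjugated by the inverse of \<open>b t\<close>. The adjugate keeps the entries polynomial in
    \<open>t\<close>, also where \<open>b t\<close> is singular.\<close>
  define N where "N t = adj_mat (b t) * snd x * b t" for t
  have \<delta>: "(\<lambda>t. det (b t)) \<in> range poly"
    by (rule poly.det[OF bc bp])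
  have N: "N t \<in> carrier_mat n n" for t
    unfolding N_def using bc adj_mat(1)[OF bc] x2 by (meson mult_carrier_mat)
  have "\<exists>m. \<exists>h\<in>range poly. \<forall>t. det (b t) \<noteq> 0 \<longrightarrow>
      det (b t) ^ m * f (M t, inverse (det (b t)) \<cdot>\<^sub>m N t) = h t"
  proof (rule poly_funs_rational_curve[OF f \<delta> _ _ N])
    show "(\<lambda>t. M t $$ (i, j)) \<in> range poly" if "i < n" "j < n" for i j
      unfolding M_def using that x1 bc bp by (auto intro!: poly.mult_mat range_poly_const)
    show "(\<lambda>t. N t $$ (i, j)) \<in> range poly" if "i < n" "j < n" for i j
      unfolding N_def
    proof (rule poly.mult_mat[OF mult_carrier_mat[OF adj_mat(1)[OF bc] x2] bc _ bp that])
      show "(\<lambda>t. (adj_mat (b t) * snd x) $$ (i, j)) \<in> range poly" if "i < n" "j < n" for i j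
        by (rule poly.mult_mat[OF adj_mat(1)[OF bc] x2 poly.adj_mat[OF bc bp] range_poly_const that])
    qed
  qed
  then obtain m h where h: "h \<in> range poly"
    "\<And>t. det (b t) \<noteq> 0 \<Longrightarrow> det (b t) ^ m * f (M t, inverse (det (b t)) \<cdot>\<^sub>m N t) = h t"
    by blast
  have eq: "(M t, inverse (det (b t)) \<cdot>\<^sub>m N t) = B_act (b t) x" if "det (b t) \<noteq> 0" for t
  proof -
    have bG: "b t \<in> GL n"
      using that bc by (simp add: GL_iff_det)
    have "inverse (det (b t)) \<cdot>\<^sub>m N t = mat_inv (b t) * snd x * b t"
      unfolding N_def mat_inv_adj_mat[OF bG]
      using mult_smult_assoc_mat[OF adj_mat(1)[OF bc] x2]
        mult_smult_assoc_mat[OF mult_carrier_mat[OF adj_mat(1)[OF bc] x2] bc] by simp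
    then show ?thesis
      by (simp add: B_act_def M_def Ad_def GL_mat_inv(2)[OF bG])
  qed
  show ?thesis
  proof
    show "(\<lambda>t. det (b t) * h t) \<in> range poly"
      by (rule poly.mult[OF \<delta> h(1)])
    show "det (b t) * h t \<noteq> 0 \<longleftrightarrow> b t \<in> Borel n \<and> f (B_act (b t) x) \<noteq> 0" for t
      using b[of t] h(2)[of t] eq[of t] by (cases "det (b t) = 0") (auto simp: Borel_iff_det)
  qed
qed

section \<open>The Zariski topology and its quotient\<close>

lemma topspace_zariski: "topspace (zariski_GL_b n) = GL n \<times> lie_b n"
proof -
  have "{p \<in> GL n \<times> lie_b n. (\<lambda>_. 1 :: 'a alg_closure) p \<noteq> 0} = GL n \<times> lie_b n"
    by auto
  then have "GL n \<times> lie_b n \<in>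
      (\<lambda>f. {p \<in> GL n \<times> lie_b n. f p \<noteq> (0 :: 'a alg_closure)}) ` poly_funs n"
    using poly_funs.one by (intro image_eqI[of _ _ "\<lambda>_. 1"]) auto
  then show ?thesis
    by (auto simp: zariski_GL_b_def)
qed

lemma openin_zariski_nonzero:
  "f \<in> poly_funs n \<Longrightarrow> openin (zariski_GL_b n) {p \<in> GL n \<times> lie_b n. f p \<noteq> 0}"
  unfolding zariski_GL_b_def by (rule topology_generated_by_Basis) auto

lemma closedin_zariski_zero:
  assumes "f \<in> poly_funs n"
  shows "closedin (zariski_GL_b n) {p \<in> GL n \<times> lie_b n. f p = 0}"
proof -
  have "{p \<in> GL n \<times> lie_b n. f p = 0} =
      topspace (zariski_GL_b n) - {p \<in> GL n \<times> lie_b n. f p \<noteq> 0}"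
    by (auto simp: topspace_zariski)
  then show ?thesis
    using openin_zariski_nonzero[OF assms] by (simp add: openin_closedin_eq)
qed

text \<open>The nonvanishing sets generate the topology and even form a base, because the
  nonvanishing set of a product is the intersection of those of its factors.\<close>

lemma openin_zariskiD:
  assumes "openin (zariski_GL_b n) U" "x \<in> U"
  obtains f where "f \<in> poly_funs n" "f x \<noteq> 0" "{p \<in> GL n \<times> lie_b n. f p \<noteq> 0} \<subseteq> U"
proof -
  let ?D = "\<lambda>f. {p \<in> GL n \<times> lie_b n. f p \<noteq> 0}"
  have "generate_topology_on (?D ` poly_funs n) U"
    using assms(1) by (simp add: zariski_GL_b_def openin_topology_generated_by_iff)
  then have "\<forall>x\<in>U. \<exists>f\<in>poly_funs n. f x \<noteq> 0 \<and> ?D f \<subseteq> U"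
  proof induction
    case (Int U V)
    show ?case
    proof
      fix x
      assume "x \<in> U \<inter> V"
      then obtain f h where "f \<in> poly_funs n" "h \<in> poly_funs n" "f x \<noteq> 0" "h x \<noteq> 0"
        "?D f \<subseteq> U" "?D h \<subseteq> V"
        using Int.IH by blast
      then show "\<exists>f\<in>poly_funs n. f x \<noteq> 0 \<and> ?D f \<subseteq> U \<inter> V"
        by (intro bexI[of _ "\<lambda>p. f p * h p"] poly_funs.mult) auto
    qed
  qed blast+
  then show ?thesis
    using assms(2) that by blast
qed

lemma closedin_zariskiD:
  assumes "closedin (zariski_GL_b n) Z" "x \<in> GL n \<times> lie_b n" "x \<notin> Z"
  obtains f where "f \<in> poly_funs n" "f x \<noteq> 0" "\<And>z. z \<in> Z \<Longrightarrow> f z = 0"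
proof -
  have "openin (zariski_GL_b n) (GL n \<times> lie_b n - Z)" and "Z \<subseteq> GL n \<times> lie_b n"
    using assms(1) by (auto simp: closedin_def topspace_zariski)
  moreover have "x \<in> GL n \<times> lie_b n - Z"
    using assms(2,3) by simp
  ultimately show ?thesis
    using that by (elim openin_zariskiD) blast+
qed

lemma topspace_G_times_B_b: "topspace (G_times_B_b n) = B_orbit n ` (GL n \<times> lie_b n)"
  by (simp add: G_times_B_b_def topspace_quotient_topology topspace_zariski)

lemma continuous_map_B_orbit: "continuous_map (zariski_GL_b n) (G_times_B_b n) (B_orbit n)"
  unfolding G_times_B_b_def by (intro quotient_imp_continuous_map quotient_map_quotient_topology)

text \<open>Density of the rational points of the Borel group: the entries are made rational one at
  a time. With the other entries held fixed, being invertible and keeping \<open>f\<close> nonzero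
  is the nonvanishing of a polynomial in the remaining entry.\<close>

lemma Borel_rational_point:
  fixes f :: "'k::field_char_0 alg_closure mat \<times> 'k alg_closure mat \<Rightarrow> 'k alg_closure"
  assumes f: "f \<in> poly_funs n" and x: "x \<in> GL n \<times> lie_b n"
    and b: "b \<in> Borel n" "f (B_act b x) \<noteq> 0"
  obtains b' where "b' \<in> Borel n" "f (B_act b' x) \<noteq> 0"
    "\<And>i j. i < n \<Longrightarrow> j < n \<Longrightarrow> b' $$ (i, j) \<in> range to_ac"
proof -
  have "\<exists>b'\<in>Borel n. f (B_act b' x) \<noteq> 0 \<and> (\<forall>ij\<in>J. b' $$ ij \<in> range to_ac)"
    if "finite J" "J \<subseteq> {..<n} \<times> {..<n}" for J
    using that
  proof (induction J)
    case empty
    show ?case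
      using b by auto
  next
    case (insert ij J)
    then obtain c where c: "c \<in> Borel n" "f (B_act c x) \<noteq> 0" "\<forall>ij\<in>J. c $$ ij \<in> range to_ac"
      by auto
    obtain i j where ij: "ij = (i, j)" "i < n" "j < n"
      using insert.prems by auto
    have cd: "dim_row c = n" "dim_col c = n" and c0: "\<And>i j. j < i \<Longrightarrow> i < n \<Longrightarrow> c $$ (i, j) = 0"
      using Borel_lie_b[OF c(1)] by (auto simp: lie_b_def)
    show ?case
    proof (cases "j < i")
      case True
      have "c $$ ij \<in> range to_ac"
        using c0[OF True ij(2)] ij(1) by (auto intro: range_eqI[of _ _ 0])
      then show ?thesis
        using c by auto
    next
      case False
      \<comment> \<open>\<open>c\<close> with the entry \<open>ij\<close> freed as the parameter
        \<open>t\<close>; the old value of the entry gives back \<open>c\<close> and shows that the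
        polynomial \<open>h\<close> is not zero.\<close>
      define e where "e t = mat n n (\<lambda>ac. if ac = ij then t else c $$ ac)" for t
      have e_in: "e t \<in> lie_b n" for t
        using False ij c0 by (auto simp: lie_b_def e_def)
      have e_poly: "(\<lambda>t. e t $$ (a, a')) \<in> range poly" if "a < n" "a' < n" for a a'
        using that range_poly_const[of "c $$ (a, a')"] range_poly_affine[of "0 :: 'k alg_closure" 1]
        by (cases "ij = (a, a')") (simp_all add: e_def)
      obtain h where h: "h \<in> range poly" "\<And>t. h t \<noteq> 0 \<longleftrightarrow> e t \<in> Borel n \<and> f (B_act (e t) x) \<noteq> 0"
        using poly_funs_Borel_curve[OF f x e_in e_poly] by blast
      have "e (c $$ ij) = c"
        by (rule eq_matI) (auto simp: e_def cd)
      then have "h (c $$ ij) \<noteq> 0"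
        using h(2) c by simp
      \<comment> \<open>Characteristic 0 enters here: \<open>k\<close> is infinite, so it is not
        contained in the finite root set of \<open>h\<close>.\<close>
      moreover have "infinite (range (to_ac :: 'k \<Rightarrow> _))"
        using inj_to_ac infinite_UNIV_char_0 finite_imageD by blast
      ultimately obtain t where t: "t \<in> range to_ac" "h t \<noteq> 0"
        using range_poly_nonzero[OF h(1)] by blast
      have "e t $$ ac \<in> range to_ac" if "ac \<in> insert ij J" for ac
      proof -
        have "fst ac < n" "snd ac < n"
          using that insert.prems by auto
        then show ?thesis
          using that t(1) c(3) by (cases ac) (auto simp: e_def)
      qed
      then show ?thesis
        using t(2) h(2) by blast
    qed
  qed
  from this[of "{..<n} \<times> {..<n}"] show ?thesis
    using that by auto
qed

lemma mat_inv_rational: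
  fixes b :: "'k::field alg_closure mat"
  assumes "b \<in> GL n"
    and "\<And>i j. i < n \<Longrightarrow> j < n \<Longrightarrow> b $$ (i, j) \<in> range to_ac"
    and "i < n" "j < n"
  shows "mat_inv b $$ (i, j) \<in> range to_ac"
proof -
  \<comment> \<open>On a one-point domain a function is a single element of the closure, so this
    algebra is \<open>k\<close> itself, and the determinant and adjugate rules become statements
    about rational matrices.\<close>
  interpret R: function_algebra "{f :: unit \<Rightarrow> 'k alg_closure. f () \<in> range to_ac}"
  proof
    show "(\<lambda>_. 0) \<in> {f :: unit \<Rightarrow> 'k alg_closure. f () \<in> range to_ac}"
      "(\<lambda>_. 1) \<in> {f :: unit \<Rightarrow> 'k alg_closure. f () \<in> range to_ac}"
      "(\<lambda>_. - 1) \<in> {f :: unit \<Rightarrow> 'k alg_closure. f () \<in> range to_ac}"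
      using rangeI[of to_ac "0 :: 'k"] rangeI[of to_ac "1 :: 'k"] rangeI[of to_ac "- 1 :: 'k"]
      by auto
  qed (auto simp flip: to_ac_add to_ac_mult)
  have b: "b \<in> carrier_mat n n"
    by (rule GL_carrier[OF assms(1)])
  note adj = adj_mat(1)[OF b]
  have "det b \<in> range to_ac"
    using R.det[of "\<lambda>_. b" n] b assms(2) by simp
  moreover have "adj_mat b $$ (i, j) \<in> range to_ac"
    using R.adj_mat[of "\<lambda>_. b" n i j] b assms by simp
  ultimately show ?thesis
    using assms(3,4) adj
    by (auto simp: mat_inv_adj_mat[OF assms(1)] simp flip: to_ac_inverse to_ac_mult)
qed

text \<open>Translation by a rational \<open>b\<close> substitutes expressions with coefficients in
  \<open>k\<close>, as the inverse of \<open>b\<close> is rational too. An irrational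
  \<open>b\<close> would bring in coefficients outside \<open>k\<close>.\<close>

lemma poly_funs_B_act:
  fixes f :: "'k::field alg_closure mat \<times> 'k alg_closure mat \<Rightarrow> 'k alg_closure"
  assumes f: "f \<in> poly_funs n" and b: "b \<in> Borel n"
    and rat: "\<And>i j. i < n \<Longrightarrow> j < n \<Longrightarrow> b $$ (i, j) \<in> range to_ac"
  obtains h where "h \<in> poly_funs n" "\<And>x. x \<in> GL n \<times> lie_b n \<Longrightarrow> h x = f (B_act b x)"
proof
  note bG = Borel_GL[OF b] and bc = Borel_carrier[OF b] and bi = mat_inv_props(1)[OF Borel_GL[OF b]]
  \<comment> \<open>A pair may consist of matrices of any size. Rebuilding them as \<open>n\<close>
    by \<open>n\<close> matrices makes the product formulas valid for all pairs and changes nothing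
    on \<open>GL n \<times> lie_b n\<close>.\<close>
  define M where "M p = mat n n (($$) (fst p))" for p :: "'k alg_closure mat \<times> 'k alg_closure mat"
  define N where "N p = mat n n (($$) (snd p))" for p :: "'k alg_closure mat \<times> 'k alg_closure mat"
  have MN: "M p \<in> carrier_mat n n" "N p \<in> carrier_mat n n" for p
    by (auto simp: M_def N_def)
  have M: "(\<lambda>p. M p $$ (i, j)) \<in> poly_funs n" and N: "(\<lambda>p. N p $$ (i, j)) \<in> poly_funs n"
    if "i < n" "j < n" for i j
    using that poly_funs.entry_fst[OF that] poly_funs.entry_snd[OF that] by (auto simp: M_def N_def)
  have const: "(\<lambda>_. c) \<in> poly_funs n" if "c \<in> range to_ac" for c :: "'k alg_closure"
    using that poly_funs.const by auto
  let ?h = "\<lambda>p. f (M p * b, mat_inv b * N p * b)"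
  show "?h \<in> poly_funs n"
  proof (rule poly_funs_compose[OF f])
    fix i j
    assume ij: "i < n" "j < n"
    show "(\<lambda>p. (M p * b) $$ (i, j)) \<in> poly_funs n"
      by (rule poly_funs.mult_mat[OF MN(1) bc M const[OF rat] ij])
    show "(\<lambda>p. (mat_inv b * N p * b) $$ (i, j)) \<in> poly_funs n"
      by (rule poly_funs.mult_mat[OF mult_carrier_mat[OF bi MN(2)] bc
            poly_funs.mult_mat[OF bi MN(2) const[OF mat_inv_rational[OF bG rat]] N] const[OF rat] ij])
  qed
  fix x :: "'k alg_closure mat \<times> 'k alg_closure mat"
  assume "x \<in> GL n \<times> lie_b n"
  then have "fst x \<in> carrier_mat n n" "snd x \<in> carrier_mat n n"
    by (auto simp: GL_def lie_b_def)
  then have "M x = fst x" "N x = snd x"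
    unfolding M_def N_def by (auto intro!: eq_matI)
  then show "?h x = f (B_act b x)"
    by (simp add: B_act_def Ad_def GL_mat_inv(2)[OF bG])
qed

text \<open>The Zariski topology is over \<open>k\<close>, so only the \<open>k\<close>-rational points of the Borel group act
  by homeomorphisms; they suffice because they are dense.\<close>

lemma openin_B_orbit_image:
  fixes U :: "('k::field_char_0 alg_closure mat \<times> 'k alg_closure mat) set"
  assumes U: "openin (zariski_GL_b n) U"
  shows "openin (G_times_B_b n) (B_orbit n ` U)"
  unfolding G_times_B_b_def openin_quotient_topology topspace_zariski
proof
  have U_sub: "U \<subseteq> GL n \<times> lie_b n"
    using openin_subset[OF U] by (simp add: topspace_zariski)
  then show "B_orbit n ` U \<subseteq> B_orbit n ` (GL n \<times> lie_b n)"
    by blast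
  let ?P = "{x \<in> GL n \<times> lie_b n. B_orbit n x \<in> B_orbit n ` U}"
  show "openin (zariski_GL_b n) ?P"
  proof (subst openin_subopen, intro ballI)
    fix x
    assume "x \<in> ?P"
    then obtain y where x: "x \<in> GL n \<times> lie_b n" and y: "y \<in> U" "B_orbit n x = B_orbit n y"
      by auto
    then obtain b where b: "b \<in> Borel n" "y = B_act b x"
      using B_orbit_eq_iff[OF x] U_sub by blast
    obtain f where f: "f \<in> poly_funs n" "f y \<noteq> 0" "{p \<in> GL n \<times> lie_b n. f p \<noteq> 0} \<subseteq> U"
      by (rule openin_zariskiD[OF U y(1)])
    \<comment> \<open>The element \<open>b\<close> that moves \<open>x\<close> into \<open>U\<close>
      may be irrational. Since \<open>f\<close> is nonzero at the moved point, density supplies a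
      rational \<open>c\<close> that also moves \<open>x\<close> into \<open>U\<close>.\<close>
    obtain c where c: "c \<in> Borel n" "f (B_act c x) \<noteq> 0"
      "\<And>i j. i < n \<Longrightarrow> j < n \<Longrightarrow> c $$ (i, j) \<in> range to_ac"
      using Borel_rational_point[OF f(1) x b(1)] f(2) b(2) by blast
    obtain h where h: "h \<in> poly_funs n" "\<And>z. z \<in> GL n \<times> lie_b n \<Longrightarrow> h z = f (B_act c z)"
      using poly_funs_B_act[OF f(1) c(1,3)] by blast
    show "\<exists>T. openin (zariski_GL_b n) T \<and> x \<in> T \<and> T \<subseteq> ?P"
    proof (intro exI conjI)
      show "openin (zariski_GL_b n) {p \<in> GL n \<times> lie_b n. h p \<noteq> 0}"
        by (rule openin_zariski_nonzero[OF h(1)])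
      show "x \<in> {p \<in> GL n \<times> lie_b n. h p \<noteq> 0}"
        using x c(2) h(2) by simp
      show "{p \<in> GL n \<times> lie_b n. h p \<noteq> 0} \<subseteq> ?P"
      proof
        fix z
        assume "z \<in> {p \<in> GL n \<times> lie_b n. h p \<noteq> 0}"
        then have z: "z \<in> GL n \<times> lie_b n" and "f (B_act c z) \<noteq> 0"
          using h(2) by auto
        then have "B_act c z \<in> {p \<in> GL n \<times> lie_b n. f p \<noteq> 0}"
          using B_act_in[OF z c(1)] by simp
        then have "B_act c z \<in> U"
          by (rule subsetD[OF f(3)])
        moreover have "B_orbit n z = B_orbit n (B_act c z)"
          using B_orbit_B_act_eq[OF z c(1)] by simp
        ultimately show "z \<in> ?P"
          using z by blast
      qed
    qed
  qed
qed

text \<open>A function that is not constant on orbits can still test closures in the quotient: the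
  quotient map is open, so the image of the nonvanishing set of \<open>f\<close> is an open set, and
  it misses \<open>S\<close>.\<close>

lemma poly_funs_vanish_closure:
  fixes f :: "'k::field_char_0 alg_closure mat \<times> 'k alg_closure mat \<Rightarrow> 'k alg_closure"
  assumes f: "f \<in> poly_funs n" and x: "x \<in> GL n \<times> lie_b n"
    and van: "\<And>y. y \<in> GL n \<times> lie_b n \<Longrightarrow> B_orbit n y \<in> S \<Longrightarrow> f y = 0"
    and cl: "B_orbit n x \<in> G_times_B_b n closure_of S"
  shows "f x = 0"
proof (rule ccontr)
  assume "f x \<noteq> 0"
  let ?U = "{p \<in> GL n \<times> lie_b n. f p \<noteq> 0}"
  have "openin (G_times_B_b n) (B_orbit n ` ?U)" and "B_orbit n x \<in> B_orbit n ` ?U"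
    using openin_B_orbit_image[OF openin_zariski_nonzero[OF f]] x \<open>f x \<noteq> 0\<close> by auto
  with cl have "\<exists>y. y \<in> S \<and> y \<in> B_orbit n ` ?U"
    by (simp only: in_closure_of)
  then obtain y where "y \<in> ?U" "B_orbit n y \<in> S"
    by auto
  then show False
    using van by auto
qed


section \<open>Irreducible sets\<close>

lemma irreducible_in_subtopology:
  "irreducible_in (subtopology Y T) S \<longleftrightarrow> S \<subseteq> T \<and> irreducible_in Y S"
proof (intro iffI conjI)
  assume S: "irreducible_in (subtopology Y T) S"
  then show ST: "S \<subseteq> T"
    by (auto simp: irreducible_in_def)
  show "irreducible_in Y S"
    unfolding irreducible_in_def
  proof (intro conjI allI impI)
    fix A B
    assume "closedin Y A" "closedin Y B" "S \<subseteq> A \<union> B"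
    then have "closedin (subtopology Y T) (A \<inter> T)" "closedin (subtopology Y T) (B \<inter> T)"
      "S \<subseteq> A \<inter> T \<union> B \<inter> T"
      using ST by (auto simp: closedin_subtopology)
    then have "S \<subseteq> A \<inter> T \<or> S \<subseteq> B \<inter> T"
      using S unfolding irreducible_in_def by blast
    then show "S \<subseteq> A \<or> S \<subseteq> B"
      by blast
  qed (use S in \<open>auto simp: irreducible_in_def\<close>)
next
  assume S: "S \<subseteq> T \<and> irreducible_in Y S"
  show "irreducible_in (subtopology Y T) S"
    unfolding irreducible_in_def
  proof (intro conjI allI impI)
    fix A B
    assume "closedin (subtopology Y T) A" "closedin (subtopology Y T) B" and AB: "S \<subseteq> A \<union> B"
    then obtain A' B' where *: "closedin Y A'" "closedin Y B'" "A = A' \<inter> T" "B = B' \<inter> T"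
      by (auto simp: closedin_subtopology)
    then have "S \<subseteq> A' \<union> B'"
      using AB by blast
    then have "S \<subseteq> A' \<or> S \<subseteq> B'"
      using S *(1,2) unfolding irreducible_in_def by blast
    then show "S \<subseteq> A \<or> S \<subseteq> B"
      using S *(3,4) by blast
  qed (use S in \<open>auto simp: irreducible_in_def\<close>)
qed

lemma irreducible_in_image:
  assumes p: "continuous_map Y Y' p" and S: "irreducible_in Y S"
  shows "irreducible_in Y' (p ` S)"
  unfolding irreducible_in_def
proof (intro conjI allI impI)
  have S': "S \<subseteq> topspace Y" "S \<noteq> {}"
    using S by (auto simp: irreducible_in_def)
  show "p ` S \<subseteq> topspace Y'"
    using S'(1) continuous_map_image_subset_topspace[OF p] by blast
  show "p ` S \<noteq> {}"
    using S'(2) by blast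
  fix A B
  assume AB: "closedin Y' A" "closedin Y' B" "p ` S \<subseteq> A \<union> B"
  have "closedin Y {x \<in> topspace Y. p x \<in> A}" "closedin Y {x \<in> topspace Y. p x \<in> B}"
    using AB closedin_continuous_map_preimage[OF p] by auto
  moreover have "S \<subseteq> {x \<in> topspace Y. p x \<in> A} \<union> {x \<in> topspace Y. p x \<in> B}"
    using AB(3) S'(1) by blast
  ultimately have "S \<subseteq> {x \<in> topspace Y. p x \<in> A} \<or> S \<subseteq> {x \<in> topspace Y. p x \<in> B}"
    using S unfolding irreducible_in_def by blast
  then show "p ` S \<subseteq> A \<or> p ` S \<subseteq> B"
    by blast
qed

text \<open>A point outside a closed set is separated from it by one function, so irreducibility
  reduces to pairs of functions with a common point of nonvanishing in \<open>S\<close>.\<close>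

lemma irreducible_in_zariskiI:
  assumes S: "S \<subseteq> GL n \<times> lie_b n" "S \<noteq> {}"
    and meet: "\<And>x y f h. x \<in> S \<Longrightarrow> y \<in> S \<Longrightarrow> f \<in> poly_funs n \<Longrightarrow> h \<in> poly_funs n \<Longrightarrow>
      f x \<noteq> 0 \<Longrightarrow> h y \<noteq> 0 \<Longrightarrow> \<exists>z\<in>S. f z \<noteq> 0 \<and> h z \<noteq> 0"
  shows "irreducible_in (zariski_GL_b n) S"
  unfolding irreducible_in_def
proof (intro conjI allI impI)
  fix A B
  assume A: "closedin (zariski_GL_b n) A" and B: "closedin (zariski_GL_b n) B" and AB: "S \<subseteq> A \<union> B"
  show "S \<subseteq> A \<or> S \<subseteq> B"
  proof (rule ccontr)
    assume "\<not> (S \<subseteq> A \<or> S \<subseteq> B)"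
    then obtain x y where xy: "x \<in> S" "x \<notin> A" "y \<in> S" "y \<notin> B"
      by blast
    obtain f where f: "f \<in> poly_funs n" "f x \<noteq> 0" "\<And>z. z \<in> A \<Longrightarrow> f z = 0"
      using closedin_zariskiD[OF A _ xy(2)] S(1) xy(1) by blast
    obtain h where h: "h \<in> poly_funs n" "h y \<noteq> 0" "\<And>z. z \<in> B \<Longrightarrow> h z = 0"
      using closedin_zariskiD[OF B _ xy(4)] S(1) xy(3) by blast
    obtain z where "z \<in> S" "f z \<noteq> 0" "h z \<noteq> 0"
      using meet[OF xy(1,3) f(1) h(1) f(2) h(2)] by blast
    then show False
      using AB f(3) h(3) by blast
  qed
qed (use S in \<open>auto simp: topspace_zariski\<close>)

text \<open>The polynomial functions restricted to an irreducible set form a domain.\<close>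

lemma irreducible_in_zariski_mult:
  assumes S: "irreducible_in (zariski_GL_b n) S" and f: "f \<in> poly_funs n" and h: "h \<in> poly_funs n"
    and "\<And>x. x \<in> S \<Longrightarrow> f x * h x = 0"
  shows "(\<forall>x\<in>S. f x = 0) \<or> (\<forall>x\<in>S. h x = 0)"
proof -
  have "S \<subseteq> GL n \<times> lie_b n"
    using S by (auto simp: irreducible_in_def topspace_zariski)
  then have "S \<subseteq> {p \<in> GL n \<times> lie_b n. f p = 0} \<union> {p \<in> GL n \<times> lie_b n. h p = 0}"
    using assms(4) by fastforce
  then have "S \<subseteq> {p \<in> GL n \<times> lie_b n. f p = 0} \<or> S \<subseteq> {p \<in> GL n \<times> lie_b n. h p = 0}"
    using S closedin_zariski_zero[OF f] closedin_zariski_zero[OF h]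
    unfolding irreducible_in_def by blast
  then show ?thesis
    by blast
qed

section \<open>Irreducibility by joining points with affine lines\<close>

definition mat_line :: "nat \<Rightarrow> 'a::comm_ring_1 mat \<Rightarrow> 'a mat \<Rightarrow> 'a \<Rightarrow> 'a mat" where
  "mat_line n A B t = mat n n (\<lambda>ij. A $$ ij + t * (B $$ ij - A $$ ij))"

lemma mat_line_ends:
  assumes "A \<in> carrier_mat n n" "B \<in> carrier_mat n n"
  shows "mat_line n A B 0 = A" "mat_line n A B 1 = B"
  using assms by (auto simp: mat_line_def intro!: eq_matI)

lemma mat_line_poly: "i < n \<Longrightarrow> j < n \<Longrightarrow> (\<lambda>t. mat_line n A B t $$ (i, j)) \<in> range poly"
  using range_poly_affine by (simp add: mat_line_def)

lemma mat_line_lie_b: "A \<in> lie_b n \<Longrightarrow> B \<in> lie_b n \<Longrightarrow> mat_line n A B t \<in> lie_b n"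
  by (auto simp: lie_b_def mat_line_def upper_triangular_def)

lemma B_orbit_subset: "x \<in> GL n \<times> lie_b n \<Longrightarrow> B_orbit n x \<subseteq> GL n \<times> lie_b n"
  unfolding B_orbit_B_act using B_act_in by blast

text \<open>Two group elements are joined by a line of upper triangular matrices. Along it each test
  function becomes a polynomial that also records invertibility, one nonzero at 0 and the other at
  1; their product has finitely many roots, so a common good parameter exists.\<close>

lemma irreducible_in_B_orbit:
  fixes x :: "'k::field_char_0 alg_closure mat \<times> 'k alg_closure mat"
  assumes x: "x \<in> GL n \<times> lie_b n"
  shows "irreducible_in (zariski_GL_b n) (B_orbit n x)"
proof (rule irreducible_in_zariskiI)
  show "B_orbit n x \<subseteq> GL n \<times> lie_b n"
    by (rule B_orbit_subset[OF x])
  show "B_orbit n x \<noteq> {}"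
    using B_orbit_self[OF x] by blast
  fix y z and f h :: "'k alg_closure mat \<times> 'k alg_closure mat \<Rightarrow> 'k alg_closure"
  assume "y \<in> B_orbit n x" "z \<in> B_orbit n x" and f: "f \<in> poly_funs n" and h: "h \<in> poly_funs n"
    and fy: "f y \<noteq> 0" and hz: "h z \<noteq> 0"
  then obtain b c where b: "b \<in> Borel n" "y = B_act b x" and c: "c \<in> Borel n" "z = B_act c x"
    by (auto simp: B_orbit_B_act)
  let ?e = "mat_line n b c"
  note e = mat_line_lie_b[OF Borel_lie_b[OF b(1)] Borel_lie_b[OF c(1)]]
  note ends = mat_line_ends[OF Borel_carrier[OF b(1)] Borel_carrier[OF c(1)]]
  obtain f' where f': "f' \<in> range poly"
    "\<And>t. f' t \<noteq> 0 \<longleftrightarrow> ?e t \<in> Borel n \<and> f (B_act (?e t) x) \<noteq> 0"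
    using poly_funs_Borel_curve[OF f x e mat_line_poly] by blast
  obtain h' where h': "h' \<in> range poly"
    "\<And>t. h' t \<noteq> 0 \<longleftrightarrow> ?e t \<in> Borel n \<and> h (B_act (?e t) x) \<noteq> 0"
    using poly_funs_Borel_curve[OF h x e mat_line_poly] by blast
  have inf: "infinite (UNIV :: 'k alg_closure set)"
    by (rule infinite_UNIV_char_0)
  have "f' 0 \<noteq> 0" "h' 1 \<noteq> 0"
    using f'(2)[of 0] h'(2)[of 1] b c fy hz ends by auto
  obtain p q where pq: "f' = poly p" "h' = poly q"
    using f'(1) h'(1) by blast
  then have "p \<noteq> 0" "q \<noteq> 0"
    using \<open>f' 0 \<noteq> 0\<close> \<open>h' 1 \<noteq> 0\<close> by auto
  then have "finite {t. poly (p * q) t = 0}"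
    by (intro poly_roots_finite) auto
  then obtain t where "poly (p * q) t \<noteq> 0"
    using inf by (metis (mono_tags, lifting) UNIV_eq_I mem_Collect_eq)
  then have "f' t \<noteq> 0" "h' t \<noteq> 0"
    using pq by auto
  then show "\<exists>z\<in>B_orbit n x. f z \<noteq> 0 \<and> h z \<noteq> 0"
    using f'(2) h'(2) by (auto simp: B_orbit_B_act)
qed

text \<open>Each fiber is a single orbit, hence irreducible, hence inside \<open>A\<close> or inside
  \<open>B\<close>. This splits \<open>Z\<close> into two parts, which are relatively closed because
  the quotient map is open, and irreducibility of \<open>Z\<close> applies.\<close>

lemma irreducible_in_preimage_B_orbit:
  fixes Z :: "'k::field_char_0 pt set"
  assumes Z: "irreducible_in (G_times_B_b n) Z"
  shows "irreducible_in (zariski_GL_b n) {x \<in> GL n \<times> lie_b n. B_orbit n x \<in> Z}" (is "irreducible_in _ ?P")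
  unfolding irreducible_in_def
proof (intro conjI allI impI)
  have ZQ: "Z \<subseteq> B_orbit n ` (GL n \<times> lie_b n)" "Z \<noteq> {}"
    using Z by (auto simp: irreducible_in_def topspace_G_times_B_b)
  show "?P \<subseteq> topspace (zariski_GL_b n)"
    by (auto simp: topspace_zariski)
  show "?P \<noteq> {}"
    using ZQ by blast
  fix A B
  assume A: "closedin (zariski_GL_b n) A" and B: "closedin (zariski_GL_b n) B" and AB: "?P \<subseteq> A \<union> B"
  \<comment> \<open>The set of orbits contained in \<open>C\<close>. For closed \<open>C\<close> its
    complement is the image of an open set.\<close>
  define U where "U C = topspace (G_times_B_b n) - B_orbit n ` (GL n \<times> lie_b n - C)"
    for C :: "('k alg_closure mat \<times> 'k alg_closure mat) set"
  have U: "closedin (G_times_B_b n) (U C)" if "closedin (zariski_GL_b n) C" for C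
    unfolding U_def using that openin_B_orbit_image by (auto simp: closedin_def topspace_zariski)
  have "Z \<subseteq> U A \<union> U B"
  proof
    fix z
    assume z: "z \<in> Z"
    then obtain x where x: "x \<in> GL n \<times> lie_b n" "z = B_orbit n x"
      using ZQ by blast
    have orb: "y \<in> B_orbit n x" if "y \<in> GL n \<times> lie_b n" "B_orbit n y = z" for y
      using B_orbit_self[OF that(1)] that(2) x(2) by simp
    have "B_orbit n x \<subseteq> ?P"
    proof
      fix y
      assume y: "y \<in> B_orbit n x"
      then obtain b where "b \<in> Borel n" "y = B_act b x"
        unfolding B_orbit_B_act by blast
      then have "B_orbit n y = z"
        using B_orbit_B_act_eq[OF x(1)] x(2) by simp
      then show "y \<in> ?P"
        using subsetD[OF B_orbit_subset[OF x(1)] y] z by simp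
    qed
    then have "B_orbit n x \<subseteq> A \<or> B_orbit n x \<subseteq> B"
      using AB A B irreducible_in_B_orbit[OF x(1)] unfolding irreducible_in_def by blast
    moreover have "z \<in> U C" if "B_orbit n x \<subseteq> C" for C
    proof -
      have "z \<notin> B_orbit n ` (GL n \<times> lie_b n - C)"
      proof
        assume "z \<in> B_orbit n ` (GL n \<times> lie_b n - C)"
        then obtain y where "y \<in> GL n \<times> lie_b n" "y \<notin> C" "B_orbit n y = z"
          by blast
        then show False
          using orb that by blast
      qed
      then show ?thesis
        using z ZQ(1) by (auto simp: U_def topspace_G_times_B_b)
    qed
    ultimately show "z \<in> U A \<union> U B"
      by blast
  qed
  then have "Z \<subseteq> U A \<or> Z \<subseteq> U B"
    using Z U[OF A] U[OF B] unfolding irreducible_in_def by blast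
  then show "?P \<subseteq> A \<or> ?P \<subseteq> B"
    unfolding U_def by blast
qed

section \<open>Finiteness of the dimension\<close>

text \<open>A function which vanishes on the next smaller member of a chain of irreducible sets but not on
  the member itself is transcendental over the functions chosen further down: in a relation on the
  top member, divide by the highest common power of that function and restrict to the next member.\<close>

lemma chain_algebraically_independent:
  fixes f :: "nat \<Rightarrow> 'k::field alg_closure mat \<times> 'k alg_closure mat \<Rightarrow> 'k alg_closure"
  assumes "\<And>i. i \<le> m \<Longrightarrow> irreducible_in (zariski_GL_b n) (Z i)"
    and "\<And>i. i < m \<Longrightarrow> Z i \<subseteq> Z (Suc i)"
    and "\<And>i. i < m \<Longrightarrow> f i \<in> poly_funs n"
    and "\<And>i x. i < m \<Longrightarrow> x \<in> Z i \<Longrightarrow> f i x = 0"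
    and "\<And>i. i < m \<Longrightarrow> \<exists>x\<in>Z (Suc i). f i x \<noteq> 0"
    and "finite E" "inj_on (\<lambda>\<alpha>. restrict \<alpha> {..<m}) E"
    and "\<And>x. x \<in> Z m \<Longrightarrow> (\<Sum>\<alpha>\<in>E. to_ac (c \<alpha>) * (\<Prod>i<m. f i x ^ \<alpha> i)) = 0"
    and "\<alpha> \<in> E"
  shows "c \<alpha> = 0"
  using assms
proof (induction m arbitrary: E \<alpha>)
  case 0
  \<comment> \<open>With no functions left all exponents have the same restriction, so the relation
    consists of one constant term.\<close>
  then have "E = {\<alpha>}"
    by (auto simp: inj_on_def)
  moreover obtain x where "x \<in> Z 0"
    using "0.prems"(1) by (force simp: irreducible_in_def)
  ultimately show ?case
    using "0.prems"(8)[of x] by simp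
next
  case (Suc m)
  show ?case
  proof (rule ccontr)
    assume "c \<alpha> \<noteq> 0"
    define E\<^sub>0 where "E\<^sub>0 = {\<beta> \<in> E. c \<beta> \<noteq> 0}"
    have E\<^sub>0: "finite E\<^sub>0" "\<alpha> \<in> E\<^sub>0"
      using Suc.prems \<open>c \<alpha> \<noteq> 0\<close> by (auto simp: E\<^sub>0_def)
    \<comment> \<open>The highest power of \<open>f m\<close> dividing every term that actually
      occurs; terms with zero coefficient were removed so as not to lower it.\<close>
    define a where "a = Min ((\<lambda>\<beta>. \<beta> m) ` E\<^sub>0)"
    have a_le: "a \<le> \<beta> m" if "\<beta> \<in> E\<^sub>0" for \<beta>
      using E\<^sub>0 that by (auto simp: a_def)
    have "a \<in> (\<lambda>\<beta>. \<beta> m) ` E\<^sub>0"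
      unfolding a_def using E\<^sub>0 by (intro Min_in) auto
    then obtain \<beta>\<^sub>0 where \<beta>\<^sub>0: "\<beta>\<^sub>0 \<in> E\<^sub>0" "\<beta>\<^sub>0 m = a"
      by blast
    define h where
      "h x = (\<Sum>\<beta>\<in>E\<^sub>0. to_ac (c \<beta>) * ((\<Prod>i<m. f i x ^ \<beta> i) * f m x ^ (\<beta> m - a)))" for x
    have h: "h \<in> poly_funs n"
      unfolding h_def
      by (intro poly_funs.sum poly_funs.mult poly_funs.prod poly_funs.power poly_funs.const Suc.prems(3)) auto
    have fm: "f m \<in> poly_funs n"
      by (simp add: Suc.prems(3))
    have "f m x ^ a * h x = 0" if "x \<in> Z (Suc m)" for x
    proof -
      have "f m x ^ a * h x =
          (\<Sum>\<beta>\<in>E\<^sub>0. to_ac (c \<beta>) * (\<Prod>i<Suc m. f i x ^ \<beta> i))"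
        unfolding h_def sum_distrib_left
      proof (rule sum.cong)
        fix \<beta>
        assume "\<beta> \<in> E\<^sub>0"
        then have "f m x ^ \<beta> m = f m x ^ a * f m x ^ (\<beta> m - a)"
          by (simp flip: power_add add: a_le)
        then show "f m x ^ a * (to_ac (c \<beta>) * ((\<Prod>i<m. f i x ^ \<beta> i) * f m x ^ (\<beta> m - a))) =
            to_ac (c \<beta>) * (\<Prod>i<Suc m. f i x ^ \<beta> i)"
          by simp
      qed simp
      also have "\<dots> = (\<Sum>\<beta>\<in>E. to_ac (c \<beta>) * (\<Prod>i<Suc m. f i x ^ \<beta> i))"
        by (rule sum.mono_neutral_left) (use Suc.prems(6) in \<open>auto simp: E\<^sub>0_def\<close>)
      finally show ?thesis
        using Suc.prems(8)[OF that] by simp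
    qed
    then have "(\<forall>x\<in>Z (Suc m). f m x ^ a = 0) \<or> (\<forall>x\<in>Z (Suc m). h x = 0)"
      by (intro irreducible_in_zariski_mult[OF _ poly_funs.power[OF fm] h] Suc.prems(1)) auto
    moreover have "\<exists>x\<in>Z (Suc m). f m x ^ a \<noteq> 0"
      using Suc.prems(5)[of m] by auto
    ultimately have h0: "h x = 0" if "x \<in> Z (Suc m)" for x
      using that by blast
    have "c \<beta>\<^sub>0 = 0"
    proof (rule Suc.IH[of "{\<beta> \<in> E\<^sub>0. \<beta> m = a}"])
      \<comment> \<open>The exponents kept agree in position \<open>m\<close>, where all have the
        value \<open>a\<close>, so they must already differ below \<open>m\<close>.\<close>
      show "inj_on (\<lambda>\<alpha>. restrict \<alpha> {..<m}) {\<beta> \<in> E\<^sub>0. \<beta> m = a}"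
      proof (rule inj_onI)
        fix \<beta> \<gamma>
        assume \<beta>: "\<beta> \<in> {\<beta> \<in> E\<^sub>0. \<beta> m = a}" and \<gamma>: "\<gamma> \<in> {\<beta> \<in> E\<^sub>0. \<beta> m = a}"
          and eq: "restrict \<beta> {..<m} = restrict \<gamma> {..<m}"
        have "\<beta> i = \<gamma> i" if "i < m" for i
          using fun_cong[OF eq, of i] that by simp
        then have eq': "restrict \<beta> {..<Suc m} = restrict \<gamma> {..<Suc m}"
          using \<beta> \<gamma> by (auto simp: restrict_def less_Suc_eq)
        show "\<beta> = \<gamma>"
        proof (rule inj_onD[OF Suc.prems(7)])
          show "restrict \<beta> {..<Suc m} = restrict \<gamma> {..<Suc m}"
            by (rule eq')
        qed (use \<beta> \<gamma> in \<open>simp_all add: E\<^sub>0_def\<close>)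
      qed
      fix x
      assume x: "x \<in> Z m"
      have "(\<Sum>\<beta>\<in>{\<beta> \<in> E\<^sub>0. \<beta> m = a}. to_ac (c \<beta>) * (\<Prod>i<m. f i x ^ \<beta> i)) = h x"
        unfolding h_def
      proof (rule sum.mono_neutral_cong_left)
        show "\<forall>\<beta>\<in>E\<^sub>0 - {\<beta> \<in> E\<^sub>0. \<beta> m = a}.
            to_ac (c \<beta>) * ((\<Prod>i<m. f i x ^ \<beta> i) * f m x ^ (\<beta> m - a)) = 0"
        proof
          fix \<beta>
          assume "\<beta> \<in> E\<^sub>0 - {\<beta> \<in> E\<^sub>0. \<beta> m = a}"
          then have "\<beta> m - a > 0"
            using a_le[of \<beta>] by auto
          then show "to_ac (c \<beta>) * ((\<Prod>i<m. f i x ^ \<beta> i) * f m x ^ (\<beta> m - a)) = 0"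
            using Suc.prems(4)[of m x] x by simp
        qed
      qed (use E\<^sub>0 in auto)
      moreover have "x \<in> Z (Suc m)"
        using Suc.prems(2)[of m] x by auto
      ultimately show "(\<Sum>\<beta>\<in>{\<beta> \<in> E\<^sub>0. \<beta> m = a}. to_ac (c \<beta>) * (\<Prod>i<m. f i x ^ \<beta> i)) = 0"
        using h0 by simp
    qed (use Suc.prems \<beta>\<^sub>0 E\<^sub>0 in auto)
    then show False
      using \<beta>\<^sub>0(1) by (simp add: E\<^sub>0_def)
  qed
qed

section \<open>A filtration of the polynomial functions by degree\<close>

interpretation ac_fun: vector_space
  "\<lambda>(c :: 'k::field) (f :: 'x \<Rightarrow> 'k alg_closure). (\<lambda>x. to_ac c * f x)"
  by standard (auto simp: fun_eq_iff algebra_simps)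

definition coord_index :: "nat \<Rightarrow> (bool \<times> nat \<times> nat) set" where
  "coord_index n = UNIV \<times> {..<n} \<times> {..<n}"

definition coord :: "bool \<times> nat \<times> nat \<Rightarrow> 'a mat \<times> 'a mat \<Rightarrow> 'a" where
  "coord = (\<lambda>(s, ij) p. (if s then fst p else snd p) $$ ij)"

text \<open>The bound \<open>d\<close> applies to each of the 2 n^2 coordinates separately, not to
  the total degree, so the exponents form a box and are counted at once.\<close>

definition monomials ::
    "nat \<Rightarrow> nat \<Rightarrow> ('a::comm_monoid_mult mat \<times> 'a mat \<Rightarrow> 'a) set" where
  "monomials n d = (\<lambda>\<beta> p. \<Prod>c\<in>coord_index n. coord c p ^ \<beta> c) ` PiE (coord_index n) (\<lambda>_. {..d})"

text \<open>The span is taken over \<open>k\<close>, not over its closure: independence along a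
  chain is available for relations with coefficients in \<open>k\<close>, and the two are compared
  by linear algebra.\<close>

definition poly_funs_deg ::
    "nat \<Rightarrow> nat \<Rightarrow> ('k::field alg_closure mat \<times> 'k alg_closure mat \<Rightarrow> 'k alg_closure) set" where
  "poly_funs_deg n d = ac_fun.span (monomials n d)"

lemma finite_coord_index: "finite (coord_index n)"
  by (simp add: coord_index_def)

lemma monomials_finite: "finite (monomials n d)" "card (monomials n d) \<le> (d + 1) ^ (2 * n * n)"
proof -
  have fin: "finite (PiE (coord_index n) (\<lambda>_. {..d}))"
    by (simp add: finite_PiE finite_coord_index)
  then show "finite (monomials n d)"
    by (simp add: monomials_def)
  have "card (monomials n d) \<le> card (PiE (coord_index n) (\<lambda>_. {..d}))"
    unfolding monomials_def by (rule card_image_le[OF fin])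
  also have "\<dots> = (d + 1) ^ (2 * n * n)"
    using finite_coord_index
    by (subst card_PiE) (auto simp: coord_index_def card_cartesian_product UNIV_bool mult_2 distrib_right)
  finally show "card (monomials n d) \<le> (d + 1) ^ (2 * n * n)" .
qed

lemma monomialsI:
  assumes "\<And>c. c \<in> coord_index n \<Longrightarrow> \<beta> c \<le> d"
  shows "(\<lambda>p. \<Prod>c\<in>coord_index n. coord c p ^ \<beta> c) \<in> monomials n d"
  unfolding monomials_def
  by (rule image_eqI[of _ _ "restrict \<beta> (coord_index n)"]) (use assms in auto)

lemma monomials_mult:
  assumes "f \<in> monomials n d" "h \<in> monomials n e"
  shows "(\<lambda>p. f p * h p) \<in> monomials n (d + e)"
proof -
  obtain \<beta> \<gamma> where \<beta>: "\<And>c. c \<in> coord_index n \<Longrightarrow> \<beta> c \<le> d"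
      "f = (\<lambda>p. \<Prod>c\<in>coord_index n. coord c p ^ \<beta> c)"
    and \<gamma>: "\<And>c. c \<in> coord_index n \<Longrightarrow> \<gamma> c \<le> e"
      "h = (\<lambda>p. \<Prod>c\<in>coord_index n. coord c p ^ \<gamma> c)"
    using assms by (auto simp: monomials_def PiE_iff)
  have "(\<lambda>p. f p * h p) = (\<lambda>p. \<Prod>c\<in>coord_index n. coord c p ^ (\<beta> c + \<gamma> c))"
    by (simp add: \<beta>(2) \<gamma>(2) prod.distrib power_add)
  also have "\<dots> \<in> monomials n (d + e)"
    using \<beta>(1) \<gamma>(1) by (intro monomialsI add_mono)
  finally show ?thesis .
qed

lemma monomials_mono: "d \<le> e \<Longrightarrow> monomials n d \<subseteq> monomials n e"
  unfolding monomials_def by (intro image_mono PiE_mono) auto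

lemma poly_funs_deg_mono: "d \<le> e \<Longrightarrow> poly_funs_deg n d \<subseteq> poly_funs_deg n e"
  unfolding poly_funs_deg_def by (intro ac_fun.span_mono monomials_mono)

lemma poly_funs_deg_add:
  "f \<in> poly_funs_deg n d \<Longrightarrow> h \<in> poly_funs_deg n d \<Longrightarrow> (\<lambda>p. f p + h p) \<in> poly_funs_deg n d"
  unfolding poly_funs_deg_def using ac_fun.span_add[of f _ h] by (simp add: plus_fun_def)

lemma poly_funs_deg_scale: "f \<in> poly_funs_deg n d \<Longrightarrow> (\<lambda>p. to_ac c * f p) \<in> poly_funs_deg n d"
  unfolding poly_funs_deg_def by (rule ac_fun.span_scale)

lemma poly_funs_deg_zero: "(\<lambda>_. 0) \<in> poly_funs_deg n d"
  unfolding poly_funs_deg_def using ac_fun.span_zero by (simp add: zero_fun_def)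

lemma poly_funs_deg_mult:
  assumes f: "f \<in> poly_funs_deg n d" and h: "h \<in> poly_funs_deg n e"
  shows "(\<lambda>p. f p * h p) \<in> poly_funs_deg n (d + e)"
proof -
  have monomial: "(\<lambda>p. f' p * h p) \<in> poly_funs_deg n (d + e)" if f': "f' \<in> monomials n d" for f'
    using h unfolding poly_funs_deg_def[of n e]
  proof (induction h rule: ac_fun.span_induct_alt)
    case base
    show ?case
      using poly_funs_deg_zero by (simp add: zero_fun_def)
  next
    case (step c h' h)
    have "(\<lambda>p. f' p * h' p) \<in> poly_funs_deg n (d + e)"
      unfolding poly_funs_deg_def by (intro ac_fun.span_base monomials_mult f' step)
    then have "(\<lambda>p. to_ac c * (f' p * h' p) + f' p * h p) \<in> poly_funs_deg n (d + e)"
      by (intro poly_funs_deg_add poly_funs_deg_scale step)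
    then show ?case
      by (simp add: algebra_simps)
  qed
  show ?thesis
    using f unfolding poly_funs_deg_def[of n d]
  proof (induction f rule: ac_fun.span_induct_alt)
    case base
    show ?case
      using poly_funs_deg_zero by (simp add: zero_fun_def)
  next
    case (step c f' f)
    have "(\<lambda>p. to_ac c * (f' p * h p) + f p * h p) \<in> poly_funs_deg n (d + e)"
      by (intro poly_funs_deg_add poly_funs_deg_scale monomial[OF step(1)] step(2))
    then show ?case
      by (simp add: algebra_simps)
  qed
qed

lemma poly_funs_deg_one:
  "(\<lambda>_ :: 'k::field alg_closure mat \<times> 'k alg_closure mat. 1) \<in> poly_funs_deg n d"
proof -
  have "(\<lambda>p :: 'k alg_closure mat \<times> 'k alg_closure mat. \<Prod>c\<in>coord_index n. coord c p ^ 0) \<in> monomials n d"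
    by (rule monomialsI) simp
  then show ?thesis
    unfolding poly_funs_deg_def by (intro ac_fun.span_base) simp
qed

lemma poly_funs_deg_coord:
  assumes "c \<in> coord_index n"
  shows "(coord c :: _ \<Rightarrow> 'k::field alg_closure) \<in> poly_funs_deg n 1"
proof -
  have "(\<lambda>p :: 'k alg_closure mat \<times> 'k alg_closure mat. \<Prod>c'\<in>coord_index n. coord c' p ^ (if c' = c then 1 else 0)) \<in> monomials n 1"
    by (rule monomialsI) simp
  moreover have "(\<Prod>c'\<in>coord_index n. coord c' p ^ (if c' = c then 1 else 0)) = coord c p"
    for p :: "'k alg_closure mat \<times> 'k alg_closure mat"
  proof -
    have "(\<Prod>c'\<in>coord_index n. coord c' p ^ (if c' = c then 1 else 0)) =
        (\<Prod>c'\<in>coord_index n. if c = c' then coord c' p else 1)"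
      by (intro prod.cong) auto
    then show ?thesis
      using assms finite_coord_index[of n] by (simp add: prod.delta)
  qed
  ultimately show ?thesis
    unfolding poly_funs_deg_def by (intro ac_fun.span_base) simp
qed

lemma poly_funs_imp_poly_funs_deg:
  assumes "f \<in> poly_funs n"
  shows "\<exists>d. f \<in> poly_funs_deg n d"
  using assms
proof induction
  case (const c)
  show ?case
    using poly_funs_deg_scale[OF poly_funs_deg_one, of c] by auto
next
  case (entry_fst i j)
  then show ?case
    using poly_funs_deg_coord[of "(True, i, j)" n] by (auto simp: coord_def coord_index_def)
next
  case (entry_snd i j)
  then show ?case
    using poly_funs_deg_coord[of "(False, i, j)" n] by (auto simp: coord_def coord_index_def)
next
  case (add f h)
  then obtain d e where "f \<in> poly_funs_deg n d" "h \<in> poly_funs_deg n e"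
    by blast
  then have "f \<in> poly_funs_deg n (d + e)" "h \<in> poly_funs_deg n (d + e)"
    using poly_funs_deg_mono[of d "d + e" n] poly_funs_deg_mono[of e "d + e" n] by auto
  then show ?case
    using poly_funs_deg_add by blast
next
  case (mult f h)
  then show ?case
    using poly_funs_deg_mult by blast
qed

lemma poly_funs_deg_power:
  "f \<in> poly_funs_deg n d \<Longrightarrow> (\<lambda>p. f p ^ a) \<in> poly_funs_deg n (a * d)"
  by (induction a) (auto intro: poly_funs_deg_one poly_funs_deg_mult)

lemma poly_funs_deg_prod:
  "(\<And>i. i < m \<Longrightarrow> f i \<in> poly_funs_deg n d) \<Longrightarrow> (\<lambda>p. \<Prod>i<m. f i p) \<in> poly_funs_deg n (m * d)"
proof (induction m)
  case (Suc m)
  then have "(\<lambda>p. (\<Prod>i<m. f i p) * f m p) \<in> poly_funs_deg n (m * d + d)"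
    by (intro poly_funs_deg_mult) auto
  then show ?case
    by (simp add: add.commute)
qed (simp add: poly_funs_deg_one)

text \<open>A chain with \<open>m\<close> strict steps yields \<open>m\<close> independent
  functions, of degree at most \<open>e\<close>. Their \<open>(N + 1) ^ m\<close> monomials with
  exponents up to \<open>N\<close> are linearly independent in a space of dimension at most
  \<open>(m * (N * e) + 1) ^ (2 * n * n)\<close>. The latter grows in \<open>N\<close> only with
  exponent \<open>2 * n * n\<close>, which bounds \<open>m\<close>.\<close>

lemma chain_length_le:
  fixes Z :: "nat \<Rightarrow> ('k::field alg_closure mat \<times> 'k alg_closure mat) set"
  assumes irr: "\<And>i. i \<le> m \<Longrightarrow> irreducible_in (zariski_GL_b n) (Z i)"
    and cl: "\<And>i. i \<le> m \<Longrightarrow> closedin (subtopology (zariski_GL_b n) S) (Z i)"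
    and less: "\<And>i. i < m \<Longrightarrow> Z i \<subset> Z (Suc i)"
  shows "m \<le> 2 * n * n"
proof -
  have "\<exists>f\<in>poly_funs n. (\<forall>x\<in>Z i. f x = 0) \<and> (\<exists>x\<in>Z (Suc i). f x \<noteq> 0)" if i: "i < m" for i
  proof -
    obtain x where x: "x \<in> Z (Suc i)" "x \<notin> Z i"
      using less[OF i] by blast
    obtain C where C: "closedin (zariski_GL_b n) C" "Z i = C \<inter> S"
      using cl[of i] i by (auto simp: closedin_subtopology)
    have xS: "x \<in> S" "x \<in> GL n \<times> lie_b n"
      using x(1) closedin_subset[OF cl[of "Suc i"]] i by (auto simp: topspace_zariski)
    then have "x \<notin> C"
      using x(2) C(2) by blast
    then obtain f where "f \<in> poly_funs n" "f x \<noteq> 0" "\<And>z. z \<in> C \<Longrightarrow> f z = 0"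
      using closedin_zariskiD[OF C(1) xS(2)] by blast
    then show ?thesis
      using x(1) C(2) by blast
  qed
  then obtain f where f: "\<And>i. i < m \<Longrightarrow> f i \<in> poly_funs n" "\<And>i x. i < m \<Longrightarrow> x \<in> Z i \<Longrightarrow> f i x = 0"
    "\<And>i. i < m \<Longrightarrow> \<exists>x\<in>Z (Suc i). f i x \<noteq> 0"
    by metis
  obtain d where d: "\<And>i. i < m \<Longrightarrow> f i \<in> poly_funs_deg n (d i)"
    using poly_funs_imp_poly_funs_deg[OF f(1)] by metis
  \<comment> \<open>A common degree bound; the inserted 0 covers the chain without steps.\<close>
  define e where "e = Max (insert 0 (d ` {..<m}))"
  have e: "f i \<in> poly_funs_deg n e" if "i < m" for i
  proof -
    have "d i \<le> e"
      using that by (auto simp: e_def)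
    then show ?thesis
      using d[OF that] poly_funs_deg_mono by blast
  qed
  define mono where "mono \<alpha> x = (\<Prod>i<m. f i x ^ \<alpha> i)" for \<alpha> x
  let ?A = "\<lambda>N. PiE {..<m} (\<lambda>_. {..N})"
  have indep: "c \<alpha> = 0"
    if "E \<subseteq> ?A N" "\<And>x. (\<Sum>\<alpha>\<in>E. to_ac (c \<alpha>) * mono \<alpha> x) = 0" "\<alpha> \<in> E" for N E c \<alpha>
  proof (rule chain_algebraically_independent[where Z = Z and f = f and m = m and n = n and E = E and c = c])
    show "Z i \<subseteq> Z (Suc i)" if "i < m" for i
      using less[OF that] by blast
    show "(\<Sum>\<alpha>\<in>E. to_ac (c \<alpha>) * (\<Prod>i<m. f i x ^ \<alpha> i)) = 0" for x
      using that(2) by (simp add: mono_def)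
    show "finite E"
      using that(1) finite_PiE[of "{..<m}" "\<lambda>_. {..N}"] finite_subset by blast
    show "inj_on (\<lambda>\<alpha>. restrict \<alpha> {..<m}) E"
      using that(1) by (intro inj_onI) (metis PiE_restrict subsetD)
  qed (use that(3) irr f in auto)
  have bound: "(N + 1) ^ m \<le> (m * (N * e) + 1) ^ (2 * n * n)" for N
  proof -
    have inj: "inj_on mono (?A N)"
    proof (rule inj_onI, rule ccontr)
      fix \<alpha> \<beta>
      assume *: "\<alpha> \<in> ?A N" "\<beta> \<in> ?A N" "mono \<alpha> = mono \<beta>" "\<alpha> \<noteq> \<beta>"
      \<comment> \<open>Two exponents with the same monomial would give the relation with
        coefficients 1 and -1.\<close>
      define c where "c \<gamma> = (if \<gamma> = \<alpha> then 1 else - 1 :: 'k)" for \<gamma>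
      have "c \<alpha> = 0"
      proof (rule indep[of "{\<alpha>, \<beta>}" N c])
        show "{\<alpha>, \<beta>} \<subseteq> ?A N"
          using *(1,2) by blast
        show "(\<Sum>\<gamma>\<in>{\<alpha>, \<beta>}. to_ac (c \<gamma>) * mono \<gamma> x) = 0" for x
          using *(4) fun_cong[OF *(3), of x] by (simp add: c_def)
      qed simp
      then show False
        by (simp add: c_def)
    qed
    have "\<not> ac_fun.dependent (mono ` ?A N)"
      unfolding ac_fun.independent_explicit_finite_subsets
    proof (intro allI impI ballI)
      fix T and u :: "('k alg_closure mat \<times> 'k alg_closure mat \<Rightarrow> 'k alg_closure) \<Rightarrow> 'k" and v
      assume T: "T \<subseteq> mono ` ?A N" "finite T" "(\<Sum>v\<in>T. (\<lambda>x. to_ac (u v) * v x)) = 0" and v: "v \<in> T"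
      define E where "E = {\<alpha> \<in> ?A N. mono \<alpha> \<in> T}"
      have TE: "T = mono ` E" and "inj_on mono E"
        using T(1) inj by (auto simp: E_def inj_on_def)
      then obtain \<alpha> where \<alpha>: "\<alpha> \<in> E" "v = mono \<alpha>"
        using v by blast
      have "(\<Sum>\<alpha>\<in>E. to_ac (u (mono \<alpha>)) * mono \<alpha> x) = 0" for x
      proof -
        have "(\<Sum>v\<in>T. (\<lambda>x. to_ac (u v) * v x)) x = (\<Sum>v\<in>T. to_ac (u v) * v x)"
          using T(2) by (induction T) simp_all
        then have "(\<Sum>v\<in>T. to_ac (u v) * v x) = 0"
          using T(3) by simp
        then show ?thesis
          unfolding TE sum.reindex[OF \<open>inj_on mono E\<close>] by simp
      qed
      then show "u v = 0"
        using indep[of E N "\<lambda>\<alpha>. u (mono \<alpha>)" \<alpha>] \<alpha> by (auto simp: E_def)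
    qed
    moreover have "mono ` ?A N \<subseteq> ac_fun.span (monomials n (m * (N * e)))"
    proof clarify
      fix \<alpha>
      assume \<alpha>: "\<alpha> \<in> ?A N"
      have "(\<lambda>p. f i p ^ \<alpha> i) \<in> poly_funs_deg n (N * e)" if "i < m" for i
      proof -
        have "\<alpha> i \<le> N"
          using \<alpha> that by (auto simp: PiE_iff)
        then have "\<alpha> i * e \<le> N * e"
          by simp
        then show ?thesis
          using poly_funs_deg_power[OF e[OF that]] poly_funs_deg_mono by blast
      qed
      then have "(\<lambda>p. \<Prod>i<m. f i p ^ \<alpha> i) \<in> poly_funs_deg n (m * (N * e))"
        by (rule poly_funs_deg_prod)
      then show "mono \<alpha> \<in> ac_fun.span (monomials n (m * (N * e)))"
        by (simp add: mono_def[abs_def] poly_funs_deg_def)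
    qed
    ultimately have "card (mono ` ?A N) \<le> card (monomials n (m * (N * e)) ::
        ('k alg_closure mat \<times> 'k alg_closure mat \<Rightarrow> 'k alg_closure) set)"
      using ac_fun.independent_span_bound[OF monomials_finite(1)] by blast
    also have "\<dots> \<le> (m * (N * e) + 1) ^ (2 * n * n)"
      by (rule monomials_finite(2))
    finally show ?thesis
      using card_image[OF inj] by (simp add: card_PiE)
  qed
  show ?thesis
  proof (rule ccontr)
    assume "\<not> m \<le> 2 * n * n"
    then obtain r where r: "m = 2 * n * n + Suc r"
      by (metis add_Suc_right less_imp_Suc_add not_le)
    \<comment> \<open>Chosen so that the growth estimate fails at \<open>N = M\<close>: the right
      side is at most \<open>M * (M + 1) ^ (2 * n * n)\<close>, while the left side has at least one
      more factor \<open>M + 1\<close>.\<close>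
    define M where "M = (m * e + 1) ^ (2 * n * n)"
    have "m * (M * e) + 1 \<le> (m * e + 1) * (M + 1)"
      by (simp add: algebra_simps)
    then have "(M + 1) ^ m \<le> ((m * e + 1) * (M + 1)) ^ (2 * n * n)"
      using bound[of M] power_mono le_trans by blast
    also have "\<dots> = M * (M + 1) ^ (2 * n * n)"
      unfolding power_mult_distrib M_def by (rule refl)
    also have "(M + 1) ^ m = (M + 1) ^ Suc r * (M + 1) ^ (2 * n * n)"
      unfolding power_add[symmetric] by (simp add: r add.commute)
    finally have "(M + 1) ^ Suc r * (M + 1) ^ (2 * n * n) \<le> M * (M + 1) ^ (2 * n * n)" .
    then have "(M + 1) ^ Suc r \<le> M"
      by simp
    moreover have "M + 1 \<le> (M + 1) ^ Suc r"
      using self_le_power[of "M + 1" "Suc r"] by simp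
    ultimately show False
      by linarith
  qed
qed

section \<open>From chains to the dimension of subsets of the quotient\<close>

lemma krull_dim_ge:
  assumes "\<And>i. i \<le> m \<Longrightarrow> closedin Y (Z i)" "\<And>i. i \<le> m \<Longrightarrow> irreducible_in Y (Z i)"
    and "\<And>i. i < m \<Longrightarrow> Z i \<subset> Z (Suc i)"
  shows "ereal (real m) \<le> krull_dim Y"
  unfolding krull_dim_def using assms by (intro Sup_upper) blast

lemma krull_dim_le:
  assumes "\<And>m Z. (\<And>i. i \<le> m \<Longrightarrow> closedin Y (Z i)) \<Longrightarrow> (\<And>i. i \<le> m \<Longrightarrow> irreducible_in Y (Z i)) \<Longrightarrow>
      (\<And>i. i < m \<Longrightarrow> Z i \<subset> Z (Suc i)) \<Longrightarrow> ereal (real m) \<le> d"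
  shows "krull_dim Y \<le> d"
  unfolding krull_dim_def using assms by (intro Sup_least) blast

text \<open>Preimages turn a chain in the quotient into one among pairs: they stay irreducible,
  relatively closed by continuity, and distinct by surjectivity. The bound is far from sharp and
  serves only to make dimensions finite.\<close>

lemma dim_of_le:
  fixes S :: "'k::field_char_0 pt set"
  shows "dim_of n S \<le> ereal (real (2 * n * n))"
  unfolding dim_of_def
proof (rule krull_dim_le)
  fix m and Z :: "nat \<Rightarrow> 'k pt set"
  assume cl: "\<And>i. i \<le> m \<Longrightarrow> closedin (subtopology (G_times_B_b n) S) (Z i)"
    and irr: "\<And>i. i \<le> m \<Longrightarrow> irreducible_in (subtopology (G_times_B_b n) S) (Z i)"
    and less: "\<And>i. i < m \<Longrightarrow> Z i \<subset> Z (Suc i)"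
  define P where "P T = {x \<in> GL n \<times> lie_b n. B_orbit n x \<in> T}" for T :: "'k pt set"
  have "m \<le> 2 * n * n"
  proof (rule chain_length_le[where Z = "\<lambda>i. P (Z i)" and S = "P S"])
    fix i
    assume i: "i \<le> m"
    show "irreducible_in (zariski_GL_b n) (P (Z i))"
      using irr[OF i] irreducible_in_preimage_B_orbit
      unfolding P_def by (auto simp: irreducible_in_subtopology)
    obtain C where C: "closedin (G_times_B_b n) C" "Z i = C \<inter> S"
      using cl[OF i] by (auto simp: closedin_subtopology)
    have "closedin (zariski_GL_b n) (P C)"
      using closedin_continuous_map_preimage[OF continuous_map_B_orbit C(1)]
      by (simp add: P_def topspace_zariski)
    moreover have "P (Z i) = P C \<inter> P S"
      by (auto simp: P_def C(2))
    ultimately show "closedin (subtopology (zariski_GL_b n) (P S)) (P (Z i))"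
      by (auto simp: closedin_subtopology)
  next
    fix i
    assume i: "i < m"
    obtain z where z: "z \<in> Z (Suc i)" "z \<notin> Z i"
      using less[OF i] by blast
    have "z \<in> B_orbit n ` (GL n \<times> lie_b n)"
      using z(1) closedin_subset[OF cl[of "Suc i"]] i by (auto simp: topspace_G_times_B_b)
    then have "\<exists>x. x \<in> P (Z (Suc i)) \<and> x \<notin> P (Z i)"
      using z by (auto simp: P_def)
    moreover have "P (Z i) \<subseteq> P (Z (Suc i))"
      using less[OF i] by (auto simp: P_def)
    ultimately show "P (Z i) \<subset> P (Z (Suc i))"
      by blast
  qed
  then show "ereal (real m) \<le> ereal (real (2 * n * n))"
    unfolding ereal_less_eq of_nat_le_iff .
qed

text \<open>Every chain in \<open>A\<close> can be continued by \<open>C\<close> itself, so its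
  length is at most one less than the dimension of \<open>C\<close>. That dimension is a real
  number: the chain consisting of \<open>C\<close> alone bounds it below, and the monomial count
  bounds it above.\<close>

lemma dim_of_less:
  fixes C :: "'k::field_char_0 pt set"
  assumes C: "irreducible_in (G_times_B_b n) C" and A: "closedin (subtopology (G_times_B_b n) C) A"
    and "A \<noteq> C"
  shows "dim_of n A < dim_of n C"
proof -
  let ?Y = "G_times_B_b n :: 'k pt topology"
  have AC: "A \<subset> C"
    using closedin_subset[OF A] assms(3) by auto
  have "C \<subseteq> topspace ?Y"
    using C by (auto simp: irreducible_in_def)
  then have CC: "closedin (subtopology ?Y C) C" "irreducible_in (subtopology ?Y C) C"
    using C closedin_topspace[of "subtopology ?Y C"]
    by (auto simp: irreducible_in_subtopology Int_absorb1)
  have "0 \<le> dim_of n C"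
    using krull_dim_ge[of 0 "subtopology ?Y C" "\<lambda>_. C"] CC by (simp add: dim_of_def zero_ereal_def)
  moreover have "dim_of n C \<le> ereal (real (2 * n * n))"
    by (rule dim_of_le)
  ultimately obtain d where d: "dim_of n C = ereal d"
    by (cases "dim_of n C") auto
  have "dim_of n A \<le> ereal (d - 1)"
    unfolding dim_of_def
  proof (rule krull_dim_le)
    fix m Z
    assume cl: "\<And>i. i \<le> m \<Longrightarrow> closedin (subtopology ?Y A) (Z i)"
      and irr: "\<And>i. i \<le> m \<Longrightarrow> irreducible_in (subtopology ?Y A) (Z i)"
      and less: "\<And>i. i < m \<Longrightarrow> Z i \<subset> Z (Suc i)"
    have sub: "subtopology ?Y A = subtopology (subtopology ?Y C) A"
      using AC by (simp add: subtopology_subtopology Int_absorb1 psubset_imp_subset)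
    define Z' where "Z' i = (if i \<le> m then Z i else C)" for i
    have "ereal (real (Suc m)) \<le> krull_dim (subtopology ?Y C)"
    proof (rule krull_dim_ge[where Z = Z'])
      fix i
      show "closedin (subtopology ?Y C) (Z' i)"
        using CC(1) cl[of i] closedin_closed_subtopology[OF A] by (auto simp: Z'_def sub)
      show "irreducible_in (subtopology ?Y C) (Z' i)"
        using CC(2) irr[of i] AC by (auto simp: Z'_def irreducible_in_subtopology)
    next
      fix i
      assume "i < Suc m"
      then show "Z' i \<subset> Z' (Suc i)"
        using less[of i] closedin_subset[OF cl[of m]] AC by (cases "i = m") (auto simp: Z'_def)
    qed
    then show "ereal (real m) \<le> ereal (d - 1)"
      using d by (simp add: dim_of_def)
  qed
  \<comment> \<open>The case split also covers an empty \<open>A\<close>, whose dimension is minus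
    infinity.\<close>
  then show ?thesis
    using d by (cases "dim_of n A") auto
qed

section \<open>The bad pair\<close>

text \<open>All inversions lie among the first four positions, as \<open>u\<close> preserves them
  and fixes the others. The length thus does not depend on \<open>n\<close>, and the computations
  below take place in the symmetric group on four letters.\<close>

lemma perm_length_S4:
  assumes "u permutes {..<4}" "4 \<le> n"
  shows "perm_length n u =
    (\<Sum>(i, j)\<in>{(0, 1), (0, 2), (0, 3), (1, 2), (1, 3), (2, 3)}. if u j < u i then 1 else 0)"
proof -
  have fix4: "u i = i" if "4 \<le> i" for i
    using permutes_not_in[OF assms(1)] that by auto
  have less4: "u i < 4" if "i < 4" for i
    using permutes_in_image[OF assms(1), of i] that by auto
  let ?P = "{(0, 1), (0, 2), (0, 3), (1, 2), (1, 3), (2, 3)} :: (nat \<times> nat) set"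
  have "inversions n u = {p \<in> ?P. u (snd p) < u (fst p)}"
  proof (intro equalityI subsetI)
    fix p
    assume "p \<in> inversions n u"
    then obtain i j where p: "p = (i, j)" "i < j" "u j < u i"
      by (auto simp: inversions_def)
    have "j < 4"
    proof (rule ccontr)
      assume "\<not> j < 4"
      then show False
        using p fix4[of j] fix4[of i] less4[of i] by (cases "i < 4") auto
    qed
    then have "i \<in> {0, 1, 2, 3}" "j \<in> {0, 1, 2, 3}"
      using p(2) by auto
    then show "p \<in> {p \<in> ?P. u (snd p) < u (fst p)}"
      using p by auto
  next
    fix p
    assume "p \<in> {p \<in> ?P. u (snd p) < u (fst p)}"
    then show "p \<in> inversions n u"
      using assms(2) by (auto simp: inversions_def)
  qed
  then have "perm_length n u = (\<Sum>p\<in>{p \<in> ?P. u (snd p) < u (fst p)}. 1)"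
    by (simp add: perm_length_def)
  also have "\<dots> = (\<Sum>p\<in>?P. if u (snd p) < u (fst p) then 1 else 0)"
    by (rule sum.inter_filter) simp
  finally show ?thesis
    by (simp add: case_prod_unfold)
qed

lemma transpose_permutes_S4: "i < 4 \<Longrightarrow> j < 4 \<Longrightarrow> transpose i j permutes {..<4::nat}"
  by (rule permutes_swap_id) auto

lemma bruhat_step_S4:
  assumes "u permutes {..<4}" "4 \<le> n" "i < 4" "j < 4" "i \<noteq> j"
    and "perm_length n u < perm_length n (transpose i j \<circ> u)"
  shows "bruhat_step n u (transpose i j \<circ> u)"
proof -
  have "u permutes {..<n}"
    using assms(1,2) by (auto intro: permutes_subset)
  moreover have "i < n" "j < n"
    using assms(2-4) by simp_all
  ultimately show ?thesis
    using assms(5,6) unfolding bruhat_step_def by blast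
qed

text \<open>The chain is 0213, 1203, 1230, 2130, 3120 in one-line notation, each step swapping two
  values and adding one inversion. Its reflections include (0 1) and (2 3), which a good pair would
  not be allowed to use.\<close>

lemma bruhat_le_bad:
  assumes n: "4 \<le> n"
  shows "bruhat_le n (transpose 1 2) (transpose 0 3)"
proof -
  define u\<^sub>0 u\<^sub>1 u\<^sub>2 u\<^sub>3 where u: "u\<^sub>0 = transpose 1 (2::nat)" "u\<^sub>1 = transpose 0 1 \<circ> u\<^sub>0"
    "u\<^sub>2 = transpose 0 3 \<circ> u\<^sub>1" "u\<^sub>3 = transpose 1 2 \<circ> u\<^sub>2"
  have p: "u\<^sub>0 permutes {..<4}" "u\<^sub>1 permutes {..<4}" "u\<^sub>2 permutes {..<4}" "u\<^sub>3 permutes {..<4}"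
    unfolding u by (intro permutes_compose transpose_permutes_S4; simp)+
  have q: "transpose 2 3 \<circ> u\<^sub>3 permutes {..<4}"
    by (intro permutes_compose transpose_permutes_S4 p) auto
  have v\<^sub>0: "u\<^sub>0 0 = 0" "u\<^sub>0 1 = 2" "u\<^sub>0 2 = 1" "u\<^sub>0 3 = 3"
    by (simp_all add: u(1) transpose_def)
  have v\<^sub>1: "u\<^sub>1 0 = 1" "u\<^sub>1 1 = 2" "u\<^sub>1 2 = 0" "u\<^sub>1 3 = 3"
    using v\<^sub>0 by (simp_all add: u(2) transpose_def)
  have v\<^sub>2: "u\<^sub>2 0 = 1" "u\<^sub>2 1 = 2" "u\<^sub>2 2 = 3" "u\<^sub>2 3 = 0"
    using v\<^sub>1 by (simp_all add: u(3) transpose_def)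
  have v\<^sub>3: "u\<^sub>3 0 = 2" "u\<^sub>3 1 = 1" "u\<^sub>3 2 = 3" "u\<^sub>3 3 = 0"
    using v\<^sub>2 by (simp_all add: u(4) transpose_def)
  have len: "perm_length n u\<^sub>0 = 1" "perm_length n u\<^sub>1 = 2" "perm_length n u\<^sub>2 = 3"
    "perm_length n u\<^sub>3 = 4" "perm_length n (transpose 2 3 \<circ> u\<^sub>3) = 5"
    unfolding perm_length_S4[OF p(1) n] perm_length_S4[OF p(2) n] perm_length_S4[OF p(3) n]
      perm_length_S4[OF p(4) n] perm_length_S4[OF q n]
    using v\<^sub>0 v\<^sub>1 v\<^sub>2 v\<^sub>3 by (simp_all add: transpose_def)
  have step: "bruhat_step n u v"
    if "u permutes {..<4}" "v = transpose i j \<circ> u" "i < 4" "j < 4" "i \<noteq> j"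
      "perm_length n u < perm_length n v" for u v i j
    using bruhat_step_S4[OF that(1) n that(3-5)] that(2,6) by simp
  have "bruhat_step n u\<^sub>0 u\<^sub>1"
    by (rule step[OF p(1) u(2)]) (simp_all add: len)
  moreover have "bruhat_step n u\<^sub>1 u\<^sub>2"
    by (rule step[OF p(2) u(3)]) (simp_all add: len)
  moreover have "bruhat_step n u\<^sub>2 u\<^sub>3"
    by (rule step[OF p(3) u(4)]) (simp_all add: len)
  moreover have "bruhat_step n u\<^sub>3 (transpose 2 3 \<circ> u\<^sub>3)"
    by (rule step[OF p(4) refl]) (simp_all add: len)
  moreover have "transpose 2 3 \<circ> u\<^sub>3 = transpose 0 3"
    by (auto simp: fun_eq_iff u transpose_def)
  ultimately have "(bruhat_step n)\<^sup>*\<^sup>* u\<^sub>0 (transpose 0 3)"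
    by (metis (no_types, lifting) rtranclp.rtrancl_into_rtrancl rtranclp.rtrancl_refl)
  then show ?thesis
    by (simp add: bruhat_le_def u(1))
qed

lemma bruhat_less_length:
  assumes "bruhat_less n u v"
  shows "perm_length n u < perm_length n v"
proof -
  have "(bruhat_step n)\<^sup>*\<^sup>* u v" and "u \<noteq> v"
    using assms by (auto simp: bruhat_less_def bruhat_le_def)
  then show ?thesis
  proof (induction rule: rtranclp_induct)
    case (step v w)
    then show ?case
      by (cases "u = v") (auto simp: bruhat_step_def)
  qed simp
qed

section \<open>Roots in the image of v - id and their reflections\<close>

lemma perm_mat_mult_vec:
  assumes v: "v permutes {..<n}" and x: "x \<in> carrier_vec n" and b: "b < n"
  shows "(perm_mat n v *\<^sub>v x) $ v b = x $ b"
proof -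
  have vb: "v b < n"
    using permutes_in_image[OF v, of b] b by simp
  have "(perm_mat n v *\<^sub>v x) $ v b = (\<Sum>c = 0..<n. (if v b = v c then 1 else 0) * x $ c)"
    using vb x by (simp add: perm_mat_def scalar_prod_def)
  also have "\<dots> = (\<Sum>c = 0..<n. if b = c then x $ c else 0)"
    using inj_eq[OF permutes_inj[OF v]] by (intro sum.cong) auto
  finally show ?thesis
    using b by simp
qed

text \<open>The positions of the entries 1 and -1 recover the ordered pair (i, j), so the definite
  description has a single candidate.\<close>

lemma root_reflection_eq:
  assumes "i < n" "j < n" "i \<noteq> j"
  shows "root_reflection n (unit_vec n i - unit_vec n j) = transpose i j"
  unfolding root_reflection_def
proof (rule the_equality)
  show "\<exists>i'<n. \<exists>j'<n. i' \<noteq> j' \<and> unit_vec n i - unit_vec n j = (unit_vec n i' - unit_vec n j' :: rat vec) \<and>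
      transpose i j = transpose i' j'"
    using assms by blast
  fix s
  assume "\<exists>i'<n. \<exists>j'<n. i' \<noteq> j' \<and> unit_vec n i - unit_vec n j = (unit_vec n i' - unit_vec n j' :: rat vec) \<and>
      s = transpose i' j'"
  then obtain i' j' where *: "i' < n" "j' < n" "s = transpose i' j'"
    "unit_vec n i - unit_vec n j = (unit_vec n i' - unit_vec n j' :: rat vec)"
    by blast
  have at: "(if i = a then 1 else 0) - (if j = a then 1 else 0) =
      (if i' = a then 1 else 0) - (if j' = a then 1 else 0 :: rat)" if "a < n" for a
  proof -
    have "(unit_vec n i - unit_vec n j :: rat vec) $ a = (unit_vec n i' - unit_vec n j') $ a"
      using *(4) by simp
    then show ?thesis
      using that assms * by (auto simp: unit_vec_def split: if_splits)
  qed
  have "i = i'" "j = j'"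
    using at[OF assms(1)] at[OF assms(2)] assms(3) by (auto split: if_splits)
  then show "s = transpose i j"
    using *(3) by simp
qed

text \<open>The coordinates of a vector in the image of v - id sum to 0 over every cycle of v. Here
  the cycles are {0, 3}, {1, 2} and fixed points, so both nonzero entries of a root lie in the same
  2-cycle.\<close>

lemma root_reflection_bad:
  assumes n: "4 \<le> n" and \<alpha>: "\<alpha> \<in> roots_of_perm n (transpose 1 2 \<circ> transpose 0 3)"
  shows "root_reflection n \<alpha> \<in> {transpose 0 3, transpose 1 2}"
proof -
  let ?v = "transpose 1 2 \<circ> transpose 0 (3::nat)"
  have v: "?v permutes {..<n}"
    using n by (intro permutes_compose permutes_swap_id) auto
  obtain i j where ij: "i < n" "j < n" "i \<noteq> j" "\<alpha> = unit_vec n i - unit_vec n j"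
    using \<alpha> by (auto simp: roots_of_perm_def roots_def)
  obtain x where x: "x \<in> carrier_vec n" "\<alpha> = perm_mat n ?v *\<^sub>v x - x"
    using \<alpha> by (auto simp: roots_of_perm_def)
  have \<alpha>_at: "\<alpha> $ ?v b = x $ b - x $ ?v b" if "b < n" for b
  proof -
    have "?v b < n"
      using permutes_in_image[OF v, of b] that by simp
    then show ?thesis
      using perm_mat_mult_vec[OF v x(1) that] x by simp
  qed
  have \<alpha>_ij: "\<alpha> $ a = (if a = i then 1 else 0) - (if a = j then 1 else 0)" if "a < n" for a
    using that ij by (auto simp: unit_vec_def)
  have "\<alpha> $ 0 + \<alpha> $ 3 = 0" "\<alpha> $ 1 + \<alpha> $ 2 = 0"
    using \<alpha>_at[of 0] \<alpha>_at[of 1] \<alpha>_at[of 2] \<alpha>_at[of 3] n by (simp_all add: transpose_def)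
  then have 1: "i = 0 \<longrightarrow> j = 3" "i = 3 \<longrightarrow> j = 0" "i = 1 \<longrightarrow> j = 2" "i = 2 \<longrightarrow> j = 1"
    using n ij(3) by (auto simp: \<alpha>_ij split: if_splits)
  have "i < 4"
  proof (rule ccontr)
    assume "\<not> i < 4"
    then have "\<alpha> $ i = 0"
      using \<alpha>_at[of i] ij(1) by (simp add: transpose_def)
    then show False
      using \<alpha>_ij[of i] ij by simp
  qed
  then have "i \<in> {0, 1, 2, 3}"
    by auto
  then show ?thesis
    using 1 root_reflection_eq[OF ij(1-3)] ij(4) by (auto simp: transpose_commute)
qed

lemma not_good_pair_bad:
  assumes n: "4 \<le> n"
  shows "\<not> good_pair n (transpose 1 2) (transpose 0 3)"
proof
  let ?s = "transpose 1 (2::nat)" and ?t = "transpose 0 (3::nat)"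
  assume "good_pair n ?s ?t"
  moreover have "?s \<circ> inv_into UNIV ?t = ?s \<circ> ?t"
    by (simp add: inv_swap_id)
  ultimately obtain \<alpha>s where \<alpha>s: "set \<alpha>s \<subseteq> roots_of_perm n (?s \<circ> ?t)"
    "?t = apply_reflections n \<alpha>s ?s"
    "\<And>i. i < length \<alpha>s \<Longrightarrow> bruhat_less n (apply_reflections n (take i \<alpha>s) ?s)
      (apply_reflections n (take (Suc i) \<alpha>s) ?s)"
    unfolding good_pair_def by metis
  have p: "?s permutes {..<4}" "?t permutes {..<4}" "?t \<circ> ?s permutes {..<4}" "id permutes {..<4::nat}"
    by (intro permutes_compose transpose_permutes_S4 permutes_id; simp)+
  have len: "perm_length n ?s = 1" "perm_length n ?t = 5" "perm_length n (?t \<circ> ?s) = 6"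
    "perm_length n id = 0"
    unfolding perm_length_S4[OF p(1) n] perm_length_S4[OF p(2) n] perm_length_S4[OF p(3) n]
      perm_length_S4[OF p(4) n]
    by (simp_all add: transpose_def)
  have "apply_reflections n (take i \<alpha>s) ?s \<in> {?s, ?t \<circ> ?s}" if "i \<le> length \<alpha>s" for i
    using that
  proof (induction i)
    case 0
    show ?case
      by (simp add: apply_reflections_def)
  next
    case (Suc i)
    let ?u = "apply_reflections n (take i \<alpha>s) ?s"
    have i: "i < length \<alpha>s"
      using Suc.prems by simp
    define r where "r = root_reflection n (\<alpha>s ! i)"
    have r: "r \<in> {?t, ?s}"
      unfolding r_def using \<alpha>s(1) nth_mem[OF i] by (intro root_reflection_bad[OF n]) blast
    have next_eq: "apply_reflections n (take (Suc i) \<alpha>s) ?s = r \<circ> ?u"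
      by (simp add: apply_reflections_def take_Suc_conv_app_nth[OF i] r_def)
    have less: "perm_length n ?u < perm_length n (r \<circ> ?u)"
      using bruhat_less_length[OF \<alpha>s(3)[OF i]] next_eq by simp
    \<comment> \<open>From the start, of length 1, one reflection leads down to the identity and the
      other up to length 6. From there both lead down, to lengths 1 and 5, so no increasing sequence
      continues.\<close>
    have comp: "?s \<circ> ?s = id" "?t \<circ> (?t \<circ> ?s) = ?s" "?s \<circ> (?t \<circ> ?s) = ?t"
      by (auto simp: fun_eq_iff transpose_def)
    have "?u \<in> {?s, ?t \<circ> ?s}"
      by (rule Suc.IH) (use i in simp)
    then have "r \<circ> ?u = ?t \<circ> ?s"
      using r less len comp by auto
    then show ?case
      using next_eq by simp
  qed
  from this[of "length \<alpha>s"] have "?t \<in> {?s, ?t \<circ> ?s}"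
    using \<alpha>s(2) by simp
  moreover have "?t 1 \<noteq> ?s 1" "?t 1 \<noteq> (?t \<circ> ?s) 1"
    by (auto simp: transpose_def)
  ultimately show False
    by (metis insert_iff singletonD)
qed

section \<open>The cells over the flag variety\<close>

lemma perm_mat_carrier: "perm_mat n w \<in> carrier_mat n n"
  by (simp add: perm_mat_def)

lemma mult_perm_mat:
  fixes A :: "'a::semiring_1 mat"
  assumes w: "w permutes {..<n}" and A: "A \<in> carrier_mat n n" and "i < n" "j < n"
  shows "(A * perm_mat n w) $$ (i, j) = A $$ (i, w j)"
proof -
  have wj: "w j < n"
    using permutes_in_image[OF w, of j] assms(4) by simp
  have "(A * perm_mat n w) $$ (i, j) = (\<Sum>k = 0..<n. A $$ (i, k) * (if k = w j then 1 else 0))"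
    using assms by (simp add: perm_mat_def scalar_prod_def)
  also have "\<dots> = (\<Sum>k = 0..<n. if k = w j then A $$ (i, k) else 0)"
    by (intro sum.cong) auto
  finally show ?thesis
    using wj by simp
qed

lemma perm_mat_mult:
  fixes A :: "'a::semiring_1 mat"
  assumes w: "w permutes {..<n}" and A: "A \<in> carrier_mat n n" and "i < n" "j < n"
  shows "(perm_mat n w * A) $$ (w i, j) = A $$ (i, j)"
proof -
  have wi: "w i < n"
    using permutes_in_image[OF w, of i] assms(3) by simp
  have "(perm_mat n w * A) $$ (w i, j) = (\<Sum>k = 0..<n. (if w i = w k then 1 else 0) * A $$ (k, j))"
    using assms wi by (simp add: perm_mat_def scalar_prod_def)
  also have "\<dots> = (\<Sum>k = 0..<n. if k = i then A $$ (k, j) else 0)"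
    using inj_eq[OF permutes_inj[OF w]] by (intro sum.cong) auto
  finally show ?thesis
    using assms(3) by simp
qed

lemma perm_mat_GL:
  assumes "w permutes {..<n}"
  shows "(perm_mat n w :: 'a::field mat) \<in> GL n"
    and "mat_inv (perm_mat n w :: 'a mat) = perm_mat n (inv_into UNIV w)"
proof -
  have comp: "perm_mat n u * perm_mat n v = (perm_mat n (u \<circ> v) :: 'a mat)"
    if "v permutes {..<n}" for u v
  proof (rule eq_matI)
    fix i j
    assume ij: "i < dim_row (perm_mat n (u \<circ> v) :: 'a mat)" "j < dim_col (perm_mat n (u \<circ> v) :: 'a mat)"
    then have "v j < n"
      using permutes_in_image[OF that, of j] by (simp add: perm_mat_def)
    with ij show "(perm_mat n u * perm_mat n v) $$ (i, j) = (perm_mat n (u \<circ> v) :: 'a mat) $$ (i, j)"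
      using mult_perm_mat[OF that perm_mat_carrier, of i j u] by (simp add: perm_mat_def)
  qed (simp_all add: perm_mat_def)
  have "perm_mat n id = (1\<^sub>m n :: 'a mat)"
    by (auto simp: perm_mat_def intro!: eq_matI)
  then have inv: "perm_mat n w * perm_mat n (inv_into UNIV w) = (1\<^sub>m n :: 'a mat)"
    "perm_mat n (inv_into UNIV w) * perm_mat n w = (1\<^sub>m n :: 'a mat)"
    using comp[OF permutes_inv[OF assms]] comp[OF assms] permutes_inv_o[OF assms] by simp_all
  show *: "(perm_mat n w :: 'a mat) \<in> GL n"
    by (rule GL_I[OF perm_mat_carrier perm_mat_carrier inv])
  show "mat_inv (perm_mat n w :: 'a mat) = perm_mat n (inv_into UNIV w)"
    by (rule mat_inv_unique[OF * perm_mat_carrier inv(1)])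
qed

lemma Ad_perm_mat:
  assumes w: "w permutes {..<n}" and \<psi>: "\<psi> \<in> carrier_mat n n" and ij: "i < n" "j < n"
  shows "Ad (perm_mat n w) \<psi> $$ (w i, w j) = \<psi> $$ (i, j)"
proof -
  have wi: "w i < n" "w j < n"
    using permutes_in_image[OF w] ij by auto
  have "Ad (perm_mat n w) \<psi> $$ (w i, w j) = (perm_mat n w * \<psi>) $$ (w i, inv_into UNIV w (w j))"
    unfolding Ad_def perm_mat_GL(2)[OF w]
    by (rule mult_perm_mat[OF permutes_inv[OF w] mult_carrier_mat[OF perm_mat_carrier \<psi>] wi])
  then show ?thesis
    using perm_mat_mult[OF w \<psi> ij] permutes_inverses(2)[OF w] by simp
qed

text \<open>The torus part of an upper triangular matrix is its diagonal, and the permutation matrix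
  of \<open>v\<close> permutes diagonal entries. The subspace is thus described by linear equations
  on entries, the form used in all later arguments.\<close>

lemma lie_t_fixed_plus_u_iff:
  assumes v: "v permutes {..<n}"
  shows "\<phi> \<in> lie_t_fixed_plus_u n v \<longleftrightarrow> \<phi> \<in> lie_b n \<and> (\<forall>i<n. \<phi> $$ (v i, v i) = \<phi> $$ (i, i))"
    (is "_ \<longleftrightarrow> ?R")
proof
  have vn: "v i < n" if "i < n" for i
    using permutes_in_image[OF v] that by auto
  assume "\<phi> \<in> lie_t_fixed_plus_u n v"
  then obtain \<tau> \<nu> where *: "\<phi> = \<tau> + \<nu>" "\<tau> \<in> lie_t n" "Ad (perm_mat n v) \<tau> = \<tau>" "\<nu> \<in> lie_u n"
    by (auto simp: lie_t_fixed_plus_u_def lie_t_fixed_def)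
  have c: "\<tau> \<in> carrier_mat n n" "\<nu> \<in> carrier_mat n n"
    using * by (auto simp: lie_t_def lie_u_def lie_b_def)
  have "\<phi> \<in> lie_b n"
    using *(1,2,4) c by (auto simp: lie_b_def lie_t_def lie_u_def diagonal_mat_def upper_triangular_def)
  moreover have "\<phi> $$ (i, i) = \<tau> $$ (i, i)" if "i < n" for i
    using that *(1,4) c by (auto simp: lie_u_def)
  moreover have "\<tau> $$ (v i, v i) = \<tau> $$ (i, i)" if "i < n" for i
    using Ad_perm_mat[OF v c(1) that that] *(3) by simp
  ultimately show ?R
    using vn by auto
next
  assume R: ?R
  then have c: "\<phi> \<in> carrier_mat n n"
    by (simp add: lie_b_def)
  define \<tau> where "\<tau> = mat n n (\<lambda>(i, j). if i = j then \<phi> $$ (i, i) else 0)"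
  have \<tau>: "\<tau> \<in> carrier_mat n n"
    by (simp add: \<tau>_def)
  have "Ad (perm_mat n v) \<tau> = \<tau>"
  proof (rule eq_matI)
    fix i j
    assume "i < dim_row \<tau>" "j < dim_col \<tau>"
    then have ij: "i < n" "j < n"
      by (auto simp: \<tau>_def)
    define i' j' where "i' = inv_into UNIV v i" "j' = inv_into UNIV v j"
    have i'j': "i' < n" "j' < n"
      using permutes_in_image[OF permutes_inv[OF v]] ij by (auto simp: i'_j'_def)
    have "i = v i'" "j = v j'"
      using permutes_inverses(1)[OF v] by (auto simp: i'_j'_def)
    moreover have "\<tau> $$ (v i', v j') = \<tau> $$ (i', j')"
      using R i'j' ij calculation inj_eq[OF permutes_inj[OF v], of i' j'] by (auto simp: \<tau>_def)
    ultimately show "Ad (perm_mat n v) \<tau> $$ (i, j) = \<tau> $$ (i, j)"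
      using Ad_perm_mat[OF v \<tau> i'j'] by simp
  qed (use Ad_carrier[OF perm_mat_GL(1)[OF v] \<tau>] \<tau> in auto)
  then have "\<tau> \<in> lie_t_fixed n v"
    by (auto simp: lie_t_fixed_def lie_t_def diagonal_mat_def \<tau>_def)
  moreover have "\<phi> - \<tau> \<in> lie_u n"
    using R c by (auto simp: lie_u_def lie_b_def \<tau>_def upper_triangular_def)
  moreover have "\<phi> = \<tau> + (\<phi> - \<tau>)"
    using c \<tau> by (intro eq_matI) auto
  ultimately show "\<phi> \<in> lie_t_fixed_plus_u n v"
    unfolding lie_t_fixed_plus_u_def by blast
qed

text \<open>Equality of cosets becomes a factorization of the representative \<open>g\<close>
  itself, because the last Borel factor absorbs the difference of representatives.\<close>

lemma V_tilde_B_orbit: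
  fixes g :: "'k::field alg_closure mat"
  assumes g: "g \<in> GL n" and \<psi>: "\<psi> \<in> lie_b n" and w: "w permutes {..<n}"
  shows "B_orbit n (g, \<psi>) \<in> V_tilde n w \<longleftrightarrow>
    Ad g \<psi> \<in> lie_b n \<and> (\<exists>b\<in>Borel n. \<exists>c\<in>Borel n. g = b * perm_mat n w * c)"
proof -
  have "coset_B n g \<in> Bruhat_cell n w \<longleftrightarrow> (\<exists>b\<in>Borel n. \<exists>c\<in>Borel n. g = b * perm_mat n w * c)"
  proof
    assume "coset_B n g \<in> Bruhat_cell n w"
    then obtain b c where bc: "b \<in> Borel n" "c \<in> Borel n"
      "coset_B n g = coset_B n (b * perm_mat n w * c)"
      by (auto simp: Bruhat_cell_def)
    have "g * 1\<^sub>m n \<in> coset_B n g"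
      unfolding coset_B_def using one_Borel by blast
    then obtain c' where c': "c' \<in> Borel n" "g = b * perm_mat n w * c * c'"
      using bc(3) GL_carrier[OF g] by (auto simp: coset_B_def)
    have "g = b * perm_mat n w * (c * c')"
      unfolding c'(2)
      by (rule assoc_mult_mat[OF mult_carrier_mat[OF Borel_carrier[OF bc(1)] perm_mat_carrier]
            Borel_carrier[OF bc(2)] Borel_carrier[OF c'(1)]])
    then show "\<exists>b\<in>Borel n. \<exists>c\<in>Borel n. g = b * perm_mat n w * c"
      using bc(1) Borel_mult[OF bc(2) c'(1)] by blast
  qed (auto simp: Bruhat_cell_def)
  moreover have "B_orbit n (g, \<psi>) \<in> topspace (G_times_B_b n)"
    using g \<psi> by (simp add: topspace_G_times_B_b)
  ultimately show ?thesis
    by (simp add: V_tilde_def X_tilde_def q_preimage_def q_map_B_orbit[OF g \<psi>] pi_map_B_orbit[OF g])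
qed

text \<open>Acting by the inverse of \<open>c\<close> replaces the representative by one with first
  component \<open>b * perm_mat n w\<close> and second component \<open>\<psi>\<^sub>1\<close>. Both
  \<open>\<psi>\<^sub>1\<close> and its conjugate by the permutation matrix are upper triangular,
  which makes the entries of \<open>\<psi>\<^sub>1\<close> at the inversions of \<open>w\<close>
  vanish.\<close>

lemma V_tilde_decomposition:
  fixes g :: "'k::field alg_closure mat"
  assumes g: "g \<in> GL n" and \<psi>: "\<psi> \<in> lie_b n" and w: "w permutes {..<n}"
    and V: "B_orbit n (g, \<psi>) \<in> V_tilde n w"
  obtains b c \<psi>\<^sub>1 where "b \<in> Borel n" "c \<in> Borel n" "g = b * perm_mat n w * c" "\<psi>\<^sub>1 \<in> lie_b n"
    "\<psi>\<^sub>1 = Ad c \<psi>" "c * \<psi> = \<psi>\<^sub>1 * c" "Ad (perm_mat n w) \<psi>\<^sub>1 \<in> lie_b n" "Ad g \<psi> \<in> lie_b n"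
    "Ad g \<psi> = Ad b (Ad (perm_mat n w) \<psi>\<^sub>1)" "\<And>i. i < n \<Longrightarrow> \<psi>\<^sub>1 $$ (i, i) = \<psi> $$ (i, i)"
proof -
  obtain b c where Ad: "Ad g \<psi> \<in> lie_b n" and b: "b \<in> Borel n" and c: "c \<in> Borel n"
    and gbc: "g = b * perm_mat n w * c"
    using V unfolding V_tilde_B_orbit[OF g \<psi> w] by blast
  let ?P = "perm_mat n w :: 'k alg_closure mat"
  note P = perm_mat_GL(1)[OF w] and bG = Borel_GL[OF b] and cG = Borel_GL[OF c]
  note ci = mat_inv_props[OF cG] and cc = Borel_carrier[OF c]
  have \<psi>c: "\<psi> \<in> carrier_mat n n"
    by (rule lie_b_carrier[OF \<psi>])
  define \<psi>\<^sub>1 where "\<psi>\<^sub>1 = Ad c \<psi>"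
  have \<psi>\<^sub>1: "\<psi>\<^sub>1 \<in> lie_b n" "\<And>i. i < n \<Longrightarrow> \<psi>\<^sub>1 $$ (i, i) = \<psi> $$ (i, i)"
    unfolding \<psi>\<^sub>1_def using Ad_Borel[OF c \<psi>] by auto
  have \<psi>\<^sub>1c: "\<psi>\<^sub>1 \<in> carrier_mat n n"
    by (rule lie_b_carrier[OF \<psi>\<^sub>1(1)])
  have eq: "Ad g \<psi> = Ad b (Ad ?P \<psi>\<^sub>1)"
    unfolding gbc \<psi>\<^sub>1_def Ad_mult[OF GL_mult(1)[OF bG P] cG \<psi>c]
    by (rule Ad_mult[OF bG P Ad_carrier[OF cG \<psi>c]])
  have "Ad ?P \<psi>\<^sub>1 = Ad (mat_inv b) (Ad g \<psi>)"
    unfolding eq by (rule Ad_mat_inv_cancel(2)[OF bG Ad_carrier[OF P \<psi>\<^sub>1c], symmetric])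
  then have "Ad ?P \<psi>\<^sub>1 \<in> lie_b n"
    using Ad_Borel(1)[OF Borel_mat_inv[OF b] Ad] by simp
  moreover have "c * \<psi> = \<psi>\<^sub>1 * c"
    unfolding \<psi>\<^sub>1_def Ad_def
    using assoc_mult_mat[OF mult_carrier_mat[OF cc \<psi>c] ci(1) cc] ci(3) right_mult_one_mat[OF mult_carrier_mat[OF cc \<psi>c]]
    by simp
  ultimately show ?thesis
    using that[OF b c gbc \<psi>\<^sub>1(1) \<psi>\<^sub>1_def _ _ Ad eq \<psi>\<^sub>1(2)] by blast
qed

text \<open>The two Borel factors leave diagonals alone, so only the permutation matrix acts on
  them.\<close>

lemma V_tilde_diag:
  fixes g :: "'k::field alg_closure mat"
  assumes g: "g \<in> GL n" and \<psi>: "\<psi> \<in> lie_b n" and w: "w permutes {..<n}"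
    and V: "B_orbit n (g, \<psi>) \<in> V_tilde n w" and j: "j < n"
  shows "Ad g \<psi> $$ (w j, w j) = \<psi> $$ (j, j)"
proof -
  obtain b c \<psi>\<^sub>1 where *: "b \<in> Borel n" "\<psi>\<^sub>1 \<in> lie_b n" "Ad (perm_mat n w) \<psi>\<^sub>1 \<in> lie_b n"
    "Ad g \<psi> = Ad b (Ad (perm_mat n w) \<psi>\<^sub>1)" "\<And>i. i < n \<Longrightarrow> \<psi>\<^sub>1 $$ (i, i) = \<psi> $$ (i, i)"
    by (rule V_tilde_decomposition[OF g \<psi> w V]) blast
  have "w j < n"
    using permutes_in_image[OF w, of j] j by simp
  then show ?thesis
    using Ad_Borel(2)[OF *(1,3)] Ad_perm_mat[OF w lie_b_carrier[OF *(2)] j j] *(4) *(5)[OF j] by simp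
qed

text \<open>The relation between diagonals passes from the cell to its closure once it is written as
  a polynomial over \<open>k\<close>: it is multiplied by the determinant, and the inverse becomes
  the adjugate.\<close>

lemma X_tilde_cell_diag:
  fixes g :: "'k::field_char_0 alg_closure mat"
  assumes g: "g \<in> GL n" and \<psi>: "\<psi> \<in> lie_b n" and w: "w permutes {..<n}"
    and X: "B_orbit n (g, \<psi>) \<in> X_tilde_cell n w" and j: "j < n"
  shows "Ad g \<psi> $$ (w j, w j) = \<psi> $$ (j, j)"
proof -
  define M where "M p = mat n n (($$) (fst p))" for p :: "'k alg_closure mat \<times> 'k alg_closure mat"
  define N where "N p = mat n n (($$) (snd p))" for p :: "'k alg_closure mat \<times> 'k alg_closure mat"
  have MN: "M p \<in> carrier_mat n n" "N p \<in> carrier_mat n n" for p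
    by (auto simp: M_def N_def)
  have M: "(\<lambda>p. M p $$ (i, j)) \<in> poly_funs n" and N: "(\<lambda>p. N p $$ (i, j)) \<in> poly_funs n"
    if "i < n" "j < n" for i j
    using that poly_funs.entry_fst[OF that] poly_funs.entry_snd[OF that] by (auto simp: M_def N_def)
  have MN_eq: "M (h, \<phi>) = h" "N (h, \<phi>) = \<phi>" if "h \<in> GL n" "\<phi> \<in> lie_b n" for h \<phi>
    using that unfolding M_def N_def by (auto intro!: eq_matI dest!: GL_carrier lie_b_carrier)
  have wj: "w j < n"
    using permutes_in_image[OF w, of j] j by simp
  let ?f = "\<lambda>p. det (M p) * N p $$ (j, j) - (M p * N p * adj_mat (M p)) $$ (w j, w j)"
  have f: "?f \<in> poly_funs n"
    by (intro poly_funs.diff poly_funs.mult poly_funs.det[OF MN(1) M] N j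
        poly_funs.mult_mat[OF mult_carrier_mat[OF MN] adj_mat(1)[OF MN(1)]
          poly_funs.mult_mat[OF MN M N] poly_funs.adj_mat[OF MN(1) M]] wj)
  have f_iff: "?f (h, \<phi>) = 0 \<longleftrightarrow> Ad h \<phi> $$ (w j, w j) = \<phi> $$ (j, j)"
    if h: "h \<in> GL n" and \<phi>: "\<phi> \<in> lie_b n" for h \<phi>
  proof -
    have hc: "h \<in> carrier_mat n n" "det h \<noteq> 0" and \<phi>c: "\<phi> \<in> carrier_mat n n"
      using h \<phi> by (auto simp: GL_iff_det lie_b_def)
    note h\<phi> = mult_carrier_mat[OF hc(1) \<phi>c]
    note a = adj_mat(1)[OF hc(1)]
    have "Ad h \<phi> = inverse (det h) \<cdot>\<^sub>m (h * \<phi> * adj_mat h)"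
      unfolding Ad_def mat_inv_adj_mat[OF h] by (rule mult_smult_distrib[OF h\<phi> a])
    then have "(h * \<phi> * adj_mat h) $$ (w j, w j) = det h * Ad h \<phi> $$ (w j, w j)"
      using hc a wj by simp
    then show ?thesis
      using hc(2) unfolding MN_eq[OF h \<phi>] by auto
  qed
  have cl: "B_orbit n (g, \<psi>) \<in> G_times_B_b n closure_of V_tilde n w"
    by (rule subsetD[OF closure_of_subtopology_subset X[unfolded X_tilde_cell_def]])
  have "?f (g, \<psi>) = 0"
  proof (rule poly_funs_vanish_closure[OF f _ _ cl])
    show "(g, \<psi>) \<in> GL n \<times> lie_b n"
      using g \<psi> by simp
    fix y :: "'k alg_closure mat \<times> 'k alg_closure mat"
    assume "y \<in> GL n \<times> lie_b n" "B_orbit n y \<in> V_tilde n w"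
    then show "?f y = 0"
      using V_tilde_diag[OF _ _ w _ j] f_iff by (cases y) blast
  qed
  then show ?thesis
    using f_iff[OF g \<psi>] by blast
qed

lemma X_tilde_cell_Int_V_tilde_subset:
  assumes w: "w permutes {..<n}" and w': "w' permutes {..<n}"
  shows "X_tilde_cell n w \<inter> V_tilde n w' \<subseteq>
    (V_tilde n w' \<inter> q_preimage n (lie_t_fixed_plus_u n (w \<circ> inv_into UNIV w')) :: 'k::field_char_0 pt set)"
proof
  fix x :: "'k pt"
  assume x: "x \<in> X_tilde_cell n w \<inter> V_tilde n w'"
  then have "x \<in> topspace (G_times_B_b n)"
    by (auto simp: V_tilde_def X_tilde_def q_preimage_def)
  then obtain g \<psi> where g: "g \<in> GL n" and \<psi>: "\<psi> \<in> lie_b n" and xg: "x = B_orbit n (g, \<psi>)"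
    by (auto simp: topspace_G_times_B_b)
  have X: "B_orbit n (g, \<psi>) \<in> X_tilde_cell n w" and V: "B_orbit n (g, \<psi>) \<in> V_tilde n w'"
    using x xg by auto
  have v: "w \<circ> inv_into UNIV w' permutes {..<n}"
    by (rule permutes_compose[OF permutes_inv[OF w'] w])
  have "Ad g \<psi> \<in> lie_b n"
    using V V_tilde_B_orbit[OF g \<psi> w'] by blast
  \<comment> \<open>With j the preimage of i under \<open>w'\<close>, both diagonal entries of
    \<open>Ad g \<psi>\<close> equal the entry j of \<psi>, one by the closure of the cell of
    \<open>w\<close>, the other by the cell of \<open>w'\<close>.\<close>
  moreover have "Ad g \<psi> $$ ((w \<circ> inv_into UNIV w') i, (w \<circ> inv_into UNIV w') i) = Ad g \<psi> $$ (i, i)" if i: "i < n" for i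
  proof -
    have j: "inv_into UNIV w' i < n"
      using permutes_in_image[OF permutes_inv[OF w'], of i] i by simp
    show ?thesis
      using X_tilde_cell_diag[OF g \<psi> w X j] V_tilde_diag[OF g \<psi> w' V j] permutes_inverses(1)[OF w']
      by simp
  qed
  ultimately have "Ad g \<psi> \<in> lie_t_fixed_plus_u n (w \<circ> inv_into UNIV w')"
    using lie_t_fixed_plus_u_iff[OF v] by blast
  then show "x \<in> V_tilde n w' \<inter> q_preimage n (lie_t_fixed_plus_u n (w \<circ> inv_into UNIV w'))"
    using V \<open>x \<in> topspace _\<close> q_map_B_orbit[OF g \<psi>] xg by (simp add: q_preimage_def)
qed

text \<open>Each orbit has a representative in which the right Borel factor is trivial. This
  parametrizes the set by the Borel group times a linear space, that is, by an open part of an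
  affine space.\<close>

lemma V_tilde_Int_q_preimage_image:
  assumes w: "w permutes {..<n}" and v: "v permutes {..<n}"
  shows "(V_tilde n w \<inter> q_preimage n (lie_t_fixed_plus_u n v) :: 'k::field pt set) =
    B_orbit n ` {(b * perm_mat n w, \<psi>) | b \<psi>.
      b \<in> Borel n \<and> \<psi> \<in> lie_b n \<and> Ad (perm_mat n w) \<psi> \<in> lie_t_fixed_plus_u n v}"
    (is "?L = B_orbit n ` ?R")
proof (intro equalityI subsetI)
  let ?P = "perm_mat n w :: 'k alg_closure mat"
  note P = perm_mat_GL(1)[OF w, where ?'a = "'k alg_closure"]
  have vn: "v i < n" if "i < n" for i
    using permutes_in_image[OF v, of i] that by simp
  fix x :: "'k pt"
  {
    assume x: "x \<in> ?L"
    then obtain g \<psi> where g: "g \<in> GL n" and \<psi>: "\<psi> \<in> lie_b n" and xg: "x = B_orbit n (g, \<psi>)"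
      by (auto simp: q_preimage_def topspace_G_times_B_b)
    then have V: "B_orbit n (g, \<psi>) \<in> V_tilde n w" and q: "Ad g \<psi> \<in> lie_t_fixed_plus_u n v"
      using x q_map_B_orbit[OF g \<psi>] by (auto simp: q_preimage_def)
    obtain b c \<psi>\<^sub>1 where b: "b \<in> Borel n" and c: "c \<in> Borel n" and gbc: "g = b * ?P * c"
      and \<psi>\<^sub>1: "\<psi>\<^sub>1 \<in> lie_b n" "\<psi>\<^sub>1 = Ad c \<psi>" and P\<psi>\<^sub>1: "Ad ?P \<psi>\<^sub>1 \<in> lie_b n"
      and eq: "Ad g \<psi> = Ad b (Ad ?P \<psi>\<^sub>1)"
      by (rule V_tilde_decomposition[OF g \<psi> w V]) blast
    have "Ad ?P \<psi>\<^sub>1 \<in> lie_t_fixed_plus_u n v"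
      using q P\<psi>\<^sub>1 Ad_Borel(2)[OF b P\<psi>\<^sub>1] vn unfolding lie_t_fixed_plus_u_iff[OF v] eq by simp
    then have "(b * ?P, \<psi>\<^sub>1) \<in> ?R"
      using b \<psi>\<^sub>1(1) by blast
    moreover have "B_orbit n (b * ?P, \<psi>\<^sub>1) = x"
    proof -
      have "B_act c (b * ?P, \<psi>\<^sub>1) = (g, \<psi>)"
        using Ad_mat_inv_cancel(2)[OF Borel_GL[OF c] lie_b_carrier[OF \<psi>]] gbc \<psi>\<^sub>1(2)
        by (simp add: B_act_def)
      moreover have "(b * ?P, \<psi>\<^sub>1) \<in> GL n \<times> lie_b n"
        using GL_mult(1)[OF Borel_GL[OF b] P] \<psi>\<^sub>1(1) by simp
      ultimately show ?thesis
        using B_orbit_B_act_eq[OF _ c] xg by metis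
    qed
    ultimately show "x \<in> B_orbit n ` ?R"
      by blast
  next
    assume "x \<in> B_orbit n ` ?R"
    then obtain b \<psi> where x: "x = B_orbit n (b * ?P, \<psi>)" and b: "b \<in> Borel n" and \<psi>: "\<psi> \<in> lie_b n"
      and q: "Ad ?P \<psi> \<in> lie_t_fixed_plus_u n v"
      by blast
    have g: "b * ?P \<in> GL n"
      by (rule GL_mult(1)[OF Borel_GL[OF b] P])
    have P\<psi>: "Ad ?P \<psi> \<in> lie_b n"
      using q lie_t_fixed_plus_u_iff[OF v] by blast
    have eq: "Ad (b * ?P) \<psi> = Ad b (Ad ?P \<psi>)"
      by (rule Ad_mult[OF Borel_GL[OF b] P lie_b_carrier[OF \<psi>]])
    have "Ad (b * ?P) \<psi> \<in> lie_t_fixed_plus_u n v"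
      using q Ad_Borel[OF b P\<psi>] vn unfolding lie_t_fixed_plus_u_iff[OF v] eq by simp
    moreover have "b * ?P = b * ?P * 1\<^sub>m n"
      by (rule right_mult_one_mat[OF GL_carrier[OF g], symmetric])
    then have "x \<in> V_tilde n w"
      unfolding x V_tilde_B_orbit[OF g \<psi> w] eq using Ad_Borel(1)[OF b P\<psi>] b one_Borel by metis
    ultimately show "x \<in> ?L"
      using x g \<psi> q_map_B_orbit[OF g \<psi>] by (simp add: q_preimage_def topspace_G_times_B_b)
  }
qed

text \<open>Two parameter points are joined by a line in both components at once. The second
  component never leaves its linear space; the first leaves the Borel group only at the roots of a
  determinant.\<close>

lemma irreducible_V_tilde_Int_q_preimage:
  assumes w: "w permutes {..<n}" and v: "v permutes {..<n}"
  shows "irreducible_in (G_times_B_b n)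
    (V_tilde n w \<inter> q_preimage n (lie_t_fixed_plus_u n v) :: 'k::field_char_0 pt set)"
  unfolding V_tilde_Int_q_preimage_image[OF w v]
proof (rule irreducible_in_image[OF continuous_map_B_orbit irreducible_in_zariskiI])
  let ?P = "perm_mat n w :: 'k alg_closure mat"
  let ?L = "{\<psi> \<in> lie_b n. Ad ?P \<psi> \<in> lie_t_fixed_plus_u n v}"
  let ?R = "{(b * ?P, \<psi>) | b \<psi>. b \<in> Borel n \<and> \<psi> \<in> lie_b n \<and> Ad ?P \<psi> \<in> lie_t_fixed_plus_u n v}"
  note P = perm_mat_GL(1)[OF w, where ?'a = "'k alg_closure"]
  have vn: "v i < n" if "i < n" for i
    using permutes_in_image[OF v, of i] that by simp
  show R_sub: "?R \<subseteq> GL n \<times> lie_b n"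
    using GL_mult(1)[OF Borel_GL P] by auto
  have "Ad ?P (0\<^sub>m n n) = 0\<^sub>m n n"
    unfolding Ad_def right_mult_zero_mat[OF perm_mat_carrier]
    by (rule left_mult_zero_mat[OF mat_inv_props(1)[OF P]])
  then have "0\<^sub>m n n \<in> ?L"
    by (simp add: lie_t_fixed_plus_u_iff[OF v] vn lie_b_def upper_triangular_def)
  then show "?R \<noteq> {}"
    using one_Borel by blast
  fix x y and f h :: "'k alg_closure mat \<times> 'k alg_closure mat \<Rightarrow> 'k alg_closure"
  assume "x \<in> ?R" "y \<in> ?R" and f: "f \<in> poly_funs n" and h: "h \<in> poly_funs n" and fx: "f x \<noteq> 0" and hy: "h y \<noteq> 0"
  then obtain b c \<psi> \<phi> where x: "x = (b * ?P, \<psi>)" and y: "y = (c * ?P, \<phi>)" and b: "b \<in> Borel n"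
    and c: "c \<in> Borel n" and \<psi>: "\<psi> \<in> ?L" and \<phi>: "\<phi> \<in> ?L"
    by blast
  let ?e = "mat_line n b c" and ?l = "mat_line n \<psi> \<phi>"
  have eb: "?e t \<in> lie_b n" for t
    by (rule mat_line_lie_b[OF Borel_lie_b[OF b] Borel_lie_b[OF c]])
  have lb: "?l t \<in> lie_b n" for t
    using \<psi> \<phi> by (intro mat_line_lie_b) auto
  have \<psi>c: "\<psi> \<in> carrier_mat n n" and \<phi>c: "\<phi> \<in> carrier_mat n n"
    using \<psi> \<phi> by (auto simp: lie_b_def)
  \<comment> \<open>Conjugation by a permutation matrix only relabels entries, so it commutes with
    forming lines, and the equations on the diagonal are linear.\<close>
  have l: "?l t \<in> ?L" for t
  proof -
    have lc: "?l t \<in> carrier_mat n n"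
      by (rule lie_b_carrier[OF lb])
    have "Ad ?P (?l t) = mat_line n (Ad ?P \<psi>) (Ad ?P \<phi>) t"
    proof (rule eq_matI)
      show "dim_row (Ad ?P (?l t)) = dim_row (mat_line n (Ad ?P \<psi>) (Ad ?P \<phi>) t)"
        "dim_col (Ad ?P (?l t)) = dim_col (mat_line n (Ad ?P \<psi>) (Ad ?P \<phi>) t)"
        using Ad_carrier[OF P lc] by (auto simp: mat_line_def)
      fix i j
      assume "i < dim_row (mat_line n (Ad ?P \<psi>) (Ad ?P \<phi>) t)" "j < dim_col (mat_line n (Ad ?P \<psi>) (Ad ?P \<phi>) t)"
      then have ij: "i < n" "j < n"
        by (auto simp: mat_line_def)
      define i' j' where "i' = inv_into UNIV w i" "j' = inv_into UNIV w j"
      have i'j': "i' < n" "j' < n"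
        using permutes_in_image[OF permutes_inv[OF w]] ij by (auto simp: i'_j'_def)
      have wij: "i = w i'" "j = w j'"
        using permutes_inverses(1)[OF w] by (auto simp: i'_j'_def)
      have "Ad ?P A $$ (i, j) = A $$ (i', j')" if "A \<in> carrier_mat n n" for A :: "'k alg_closure mat"
        unfolding wij by (rule Ad_perm_mat[OF w that i'j'])
      then show "Ad ?P (?l t) $$ (i, j) = mat_line n (Ad ?P \<psi>) (Ad ?P \<phi>) t $$ (i, j)"
        using lc \<psi>c \<phi>c ij i'j' by (simp add: mat_line_def)
    qed
    moreover have "mat_line n A B t \<in> lie_t_fixed_plus_u n v"
      if "A \<in> lie_t_fixed_plus_u n v" "B \<in> lie_t_fixed_plus_u n v" for A B :: "'k alg_closure mat"
      using that vn mat_line_lie_b[of A n B t] unfolding lie_t_fixed_plus_u_iff[OF v]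
      by (simp add: mat_line_def)
    ultimately show ?thesis
      using \<psi> \<phi> lb by simp
  qed
  have poly: "(\<lambda>t. u (?e t * ?P, ?l t)) \<in> range poly" if "u \<in> poly_funs n" for u
  proof (rule poly_funs_curve[OF that])
    show "(\<lambda>t. (?e t * ?P) $$ (i, j)) \<in> range poly" if "i < n" "j < n" for i j
      by (rule poly.mult_mat[OF lie_b_carrier[OF eb] perm_mat_carrier mat_line_poly range_poly_const that])
  qed (rule mat_line_poly)
  have det: "(\<lambda>t. det (?e t)) \<in> range poly"
    by (rule poly.det[OF lie_b_carrier[OF eb] mat_line_poly])
  note ends = mat_line_ends[OF Borel_carrier[OF b] Borel_carrier[OF c]] mat_line_ends[OF \<psi>c \<phi>c]
  \<comment> \<open>The determinant and \<open>f\<close> are nonzero at 0 and \<open>h\<close> is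
    nonzero at 1, so the product of the three polynomials is not zero.\<close>
  obtain t where "det (?e t) \<noteq> 0" "f (?e t * ?P, ?l t) \<noteq> 0" "h (?e t * ?P, ?l t) \<noteq> 0"
  proof -
    obtain p\<^sub>0 p\<^sub>1 p\<^sub>2 where p: "(\<lambda>t. det (?e t)) = poly p\<^sub>0" "(\<lambda>t. f (?e t * ?P, ?l t)) = poly p\<^sub>1"
      "(\<lambda>t. h (?e t * ?P, ?l t)) = poly p\<^sub>2"
      using det poly[OF f] poly[OF h] by (elim rangeE) blast
    have "poly p\<^sub>0 0 \<noteq> 0" "poly p\<^sub>1 0 \<noteq> 0" "poly p\<^sub>2 1 \<noteq> 0"
      unfolding p[symmetric] using b fx hy x y by (simp_all add: ends Borel_iff_det)
    then have "p\<^sub>0 * p\<^sub>1 * p\<^sub>2 \<noteq> 0"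
      by auto
    then have "finite {t. poly (p\<^sub>0 * p\<^sub>1 * p\<^sub>2) t = 0}"
      by (rule poly_roots_finite)
    then obtain t where "poly (p\<^sub>0 * p\<^sub>1 * p\<^sub>2) t \<noteq> 0"
      using infinite_UNIV_char_0[where ?'a = "'k alg_closure"]
      by (metis (mono_tags, lifting) UNIV_eq_I mem_Collect_eq)
    then show ?thesis
      using that[of t] fun_cong[OF p(1), of t] fun_cong[OF p(2), of t] fun_cong[OF p(3), of t] by simp
  qed
  moreover from this(1) have "?e t \<in> Borel n"
    using eb by (simp add: Borel_iff_det)
  ultimately show "\<exists>z\<in>?R. f z \<noteq> 0 \<and> h z \<noteq> 0"
    using l[of t] by (intro bexI[of _ "(?e t * ?P, ?l t)"]) auto
qed

section \<open>The additional equation\<close>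

text \<open>For \<open>g = b w c\<close> the matrix \<open>Ad(c) \<psi> - \<psi>\<^sub>0\<^sub>0\<close> maps the span of the first two basis
  vectors into the line of the second one, and \<open>b w\<close> maps this line to that of column 1 of \<open>b\<close>.\<close>

lemma X_tilde_cell_equation:
  fixes g :: "'k::field_char_0 alg_closure mat"
  assumes n: "4 \<le> n" and g: "g \<in> GL n" and \<psi>: "\<psi> \<in> lie_b n"
    and X: "B_orbit n (g, \<psi>) \<in> X_tilde_cell n (transpose 0 3)"
  shows "(g * \<psi>) $$ (2, 1) = \<psi> $$ (0, 0) * g $$ (2, 1)"
proof -
  let ?w = "transpose 0 (3::nat)"
  have w: "?w permutes {..<n}"
    using n by (intro permutes_swap_id) auto
  let ?f = "\<lambda>p :: 'k alg_closure mat \<times> 'k alg_closure mat.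
    (\<Sum>k<n. fst p $$ (2, k) * snd p $$ (k, 1)) - snd p $$ (0, 0) * fst p $$ (2, 1)"
  have f: "?f \<in> poly_funs n"
    using n by (intro poly_funs.diff poly_funs.sum poly_funs.mult poly_funs.entry_fst poly_funs.entry_snd) auto
  have f_eq: "?f (h, \<phi>) = (h * \<phi>) $$ (2, 1) - \<phi> $$ (0, 0) * h $$ (2, 1)"
    if "h \<in> carrier_mat n n" "\<phi> \<in> carrier_mat n n" for h \<phi>
    using that n by (simp add: scalar_prod_def lessThan_atLeast0)
  have cl: "B_orbit n (g, \<psi>) \<in> G_times_B_b n closure_of V_tilde n ?w"
    by (rule subsetD[OF closure_of_subtopology_subset X[unfolded X_tilde_cell_def]])
  have "?f (g, \<psi>) = 0"
  proof (rule poly_funs_vanish_closure[OF f _ _ cl])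
    show "(g, \<psi>) \<in> GL n \<times> lie_b n"
      using g \<psi> by simp
    fix y :: "'k alg_closure mat \<times> 'k alg_closure mat"
    assume y: "y \<in> GL n \<times> lie_b n" "B_orbit n y \<in> V_tilde n ?w"
    obtain h \<phi> where h\<phi>: "y = (h, \<phi>)" "h \<in> GL n" "\<phi> \<in> lie_b n"
      using y(1) by (cases y) auto
    have V: "B_orbit n (h, \<phi>) \<in> V_tilde n ?w"
      using y(2) h\<phi>(1) by simp
    let ?P = "perm_mat n ?w :: 'k alg_closure mat"
    obtain b c \<phi>\<^sub>1 where b: "b \<in> Borel n" and c: "c \<in> Borel n" and hbc: "h = b * ?P * c"
      and \<phi>\<^sub>1: "\<phi>\<^sub>1 \<in> lie_b n" and comm: "c * \<phi> = \<phi>\<^sub>1 * c" and P\<phi>\<^sub>1: "Ad ?P \<phi>\<^sub>1 \<in> lie_b n"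
      and diag: "\<And>i. i < n \<Longrightarrow> \<phi>\<^sub>1 $$ (i, i) = \<phi> $$ (i, i)"
      by (rule V_tilde_decomposition[OF h\<phi>(2,3) w V]) blast
    note bc = Borel_carrier[OF b] and cc = Borel_carrier[OF c]
      and \<phi>c = lie_b_carrier[OF h\<phi>(3)] and \<phi>\<^sub>1c = lie_b_carrier[OF \<phi>\<^sub>1]
    define d where "d = b * ?P"
    have dc: "d \<in> carrier_mat n n"
      unfolding d_def by (rule mult_carrier_mat[OF bc perm_mat_carrier])
    have ut: "A $$ (k, j) = 0" if "A \<in> lie_b n" "j < k" "k < n" for A :: "'k alg_closure mat" and j k
      using that by (auto simp: lie_b_def)
    \<comment> \<open>\<open>w\<close> fixes 1, so column 1 of \<open>d\<close> is column 1 of the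
      upper triangular \<open>b\<close>.\<close>
    have d21: "d $$ (2, 1) = 0"
      using mult_perm_mat[OF w bc, of 2 1] ut[OF Borel_lie_b[OF b], of 1 2] n
      by (simp add: d_def transpose_def)
    \<comment> \<open>The inversion (0, 1) of \<open>w\<close>: its entry moves to (3, 1), which is
      below the diagonal.\<close>
    have "Ad ?P \<phi>\<^sub>1 $$ (?w 0, ?w 1) = \<phi>\<^sub>1 $$ (0, 1)"
      using n by (intro Ad_perm_mat[OF w \<phi>\<^sub>1c]) auto
    moreover have "Ad ?P \<phi>\<^sub>1 $$ (3, 1) = 0"
      using n by (intro ut[OF P\<phi>\<^sub>1]) auto
    ultimately have \<phi>\<^sub>101: "\<phi>\<^sub>1 $$ (0, 1) = 0"
      by (simp add: transpose_def)
    \<comment> \<open>Row 0 of the second factor vanishes by the inversion (0, 1) and the equality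
      of diagonals, row 1 meets the zero entry of \<open>d\<close>, and the later rows vanish in
      column 1 by triangularity.\<close>
    have term0: "d $$ (2, k) * ((\<phi>\<^sub>1 * c) $$ (k, 1) - \<phi> $$ (0, 0) * c $$ (k, 1)) = 0" if k: "k < n" for k
    proof -
      consider "k = 0" | "k = 1" | "1 < k"
        by linarith
      then show ?thesis
      proof cases
        case 1
        have "(\<phi>\<^sub>1 * c) $$ (0, 1) = (\<Sum>l = 0..<n. \<phi>\<^sub>1 $$ (0, l) * c $$ (l, 1))"
          using n \<phi>\<^sub>1c cc by (simp add: scalar_prod_def)
        also have "\<dots> = (\<Sum>l\<in>{0}. \<phi>\<^sub>1 $$ (0, l) * c $$ (l, 1))"
        proof (rule sum.mono_neutral_right)
          show "\<forall>l\<in>{0..<n} - {0}. \<phi>\<^sub>1 $$ (0, l) * c $$ (l, 1) = 0"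
          proof
            fix l
            assume "l \<in> {0..<n} - {0}"
            then show "\<phi>\<^sub>1 $$ (0, l) * c $$ (l, 1) = 0"
              using \<phi>\<^sub>101 ut[OF Borel_lie_b[OF c], of 1 l] by (cases "l = 1") auto
          qed
        qed (use n in auto)
        finally show ?thesis
          using 1 diag[of 0] n by simp
      next
        case 2
        then show ?thesis
          using d21 by simp
      next
        case 3
        then show ?thesis
          using ut[OF lie_b_mult(1)[OF \<phi>\<^sub>1 Borel_lie_b[OF c]] 3 k] ut[OF Borel_lie_b[OF c] 3 k] by simp
      qed
    qed
    have "(h * \<phi>) $$ (2, 1) = (d * (\<phi>\<^sub>1 * c)) $$ (2, 1)"
      using assoc_mult_mat[OF dc cc \<phi>c] comm hbc by (simp add: d_def)
    also have "\<dots> = (\<Sum>k = 0..<n. d $$ (2, k) * (\<phi>\<^sub>1 * c) $$ (k, 1))"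
      using n dc \<phi>\<^sub>1c cc by (simp add: scalar_prod_def)
    finally have 1: "(h * \<phi>) $$ (2, 1) = (\<Sum>k = 0..<n. d $$ (2, k) * (\<phi>\<^sub>1 * c) $$ (k, 1))" .
    have "h $$ (2, 1) = (\<Sum>k = 0..<n. d $$ (2, k) * c $$ (k, 1))"
      unfolding hbc d_def[symmetric] using n dc cc by (simp add: scalar_prod_def)
    with 1 have "(h * \<phi>) $$ (2, 1) - \<phi> $$ (0, 0) * h $$ (2, 1) =
        (\<Sum>k = 0..<n. d $$ (2, k) * ((\<phi>\<^sub>1 * c) $$ (k, 1) - \<phi> $$ (0, 0) * c $$ (k, 1)))"
      by (simp add: sum_distrib_left sum_subtractf algebra_simps)
    also have "\<dots> = 0"
      using term0 by (intro sum.neutral) auto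
    finally show "?f y = 0"
      unfolding h\<phi>(1) f_eq[OF GL_carrier[OF h\<phi>(2)] \<phi>c] .
  qed
  then show ?thesis
    unfolding f_eq[OF GL_carrier[OF g] lie_b_carrier[OF \<psi>]] by simp
qed

theorem theorem1p10:
  fixes n :: nat
  assumes "n \<ge> 4"
  shows
    "(\<exists>w w'. w permutes {..<n} \<and> w' permutes {..<n} \<and> bruhat_le n w' w \<and> bad_pair n w' w \<and>
        dim_of n (X_tilde_cell n w \<inter> V_tilde n w' :: 'k::field_char_0 pt set) <
        dim_of n (V_tilde n w' \<inter> q_preimage n (lie_t_fixed_plus_u n (w \<circ> inv_into UNIV w')) :: 'k pt set))
     \<and>
     \<not> (\<forall>w w'. w permutes {..<n} \<longrightarrow> w' permutes {..<n} \<longrightarrow> bruhat_le n w' w \<longrightarrow>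
        (V_tilde n w' \<inter> X_tilde_cell n w :: 'k pt set) =
        V_tilde n w' \<inter> q_preimage n (lie_t_fixed_plus_u n (w \<circ> inv_into UNIV w')))"
proof -
  let ?w = "transpose 0 (3::nat)" and ?w' = "transpose 1 (2::nat)"
  let ?v = "?w \<circ> inv_into UNIV ?w'"
  let ?A = "X_tilde_cell n ?w \<inter> V_tilde n ?w' :: 'k pt set"
  let ?C = "V_tilde n ?w' \<inter> q_preimage n (lie_t_fixed_plus_u n ?v) :: 'k pt set"
  have w: "?w permutes {..<n}" and w': "?w' permutes {..<n}"
    using assms by (auto intro: permutes_swap_id)
  have v: "?v permutes {..<n}"
    by (rule permutes_compose[OF permutes_inv[OF w'] w])
  have v_eq: "?v = ?w \<circ> ?w'"
    by (simp add: inv_swap_id)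
  note le = bruhat_le_bad[OF assms]
  have bad: "bad_pair n ?w' ?w"
    using le not_good_pair_bad[OF assms] by (simp add: bad_pair_def)
  have sub: "?A \<subseteq> ?C"
    by (rule X_tilde_cell_Int_V_tilde_subset[OF w w'])
  have "?A \<noteq> ?C"
  proof
    assume eq: "?A = ?C"
    let ?P = "perm_mat n ?w' :: 'k alg_closure mat"
    \<comment> \<open>The simplest element of the fixed torus whose two eigenvalues differ: 1 at the
      positions 1 and 2, and 0 at 0 and 3. It commutes with the matrix of \<open>w'\<close>. As
      \<open>w'\<close> sends 1 to 2, the additional equation at this point reads 1 = 0.\<close>
    define \<psi> :: "'k alg_closure mat"
      where "\<psi> = mat n n (\<lambda>(i, j). if i = j \<and> i \<in> {1, 2} then 1 else 0)"
    have \<psi>: "\<psi> \<in> lie_b n" and \<psi>c: "\<psi> \<in> carrier_mat n n"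
      by (auto simp: \<psi>_def lie_b_def)
    have "Ad ?P \<psi> = \<psi>"
    proof (rule eq_matI)
      fix i j
      assume "i < dim_row \<psi>" "j < dim_col \<psi>"
      then have ij: "i < n" "j < n"
        by (auto simp: \<psi>_def)
      then have w'ij: "?w' i < n" "?w' j < n"
        using permutes_in_image[OF w'] by auto
      have "Ad ?P \<psi> $$ (i, j) = \<psi> $$ (?w' i, ?w' j)"
        using Ad_perm_mat[OF w' \<psi>c w'ij] by simp
      also have "\<dots> = \<psi> $$ (i, j)"
        using ij w'ij by (auto simp: \<psi>_def transpose_def)
      finally show "Ad ?P \<psi> $$ (i, j) = \<psi> $$ (i, j)" .
    qed (use Ad_carrier[OF perm_mat_GL(1)[OF w'] \<psi>c] \<psi>c in auto)
    moreover have "\<psi> \<in> lie_t_fixed_plus_u n ?v"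
      unfolding lie_t_fixed_plus_u_iff[OF v] unfolding v_eq using \<psi> assms
      by (auto simp: \<psi>_def transpose_def)
    ultimately have "(1\<^sub>m n * ?P, \<psi>) \<in> {(b * ?P, \<psi>) | b \<psi>.
        b \<in> Borel n \<and> \<psi> \<in> lie_b n \<and> Ad ?P \<psi> \<in> lie_t_fixed_plus_u n ?v}"
      using \<psi> one_Borel by (intro CollectI exI[of _ "1\<^sub>m n"] exI[of _ \<psi>]) simp
    then have "B_orbit n (1\<^sub>m n * ?P, \<psi>) \<in> ?C"
      unfolding V_tilde_Int_q_preimage_image[OF w' v] by (rule imageI)
    then have "B_orbit n (?P, \<psi>) \<in> ?A"
      unfolding eq left_mult_one_mat[OF perm_mat_carrier] .
    then have "B_orbit n (?P, \<psi>) \<in> X_tilde_cell n ?w"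
      by (rule IntD1)
    then have "(?P * \<psi>) $$ (2, 1) = \<psi> $$ (0, 0) * ?P $$ (2, 1)"
      by (rule X_tilde_cell_equation[OF assms perm_mat_GL(1)[OF w'] \<psi>])
    moreover have "(?P * \<psi>) $$ (?w' 1, 1) = \<psi> $$ (1, 1)"
      using assms by (intro perm_mat_mult[OF w' \<psi>c]) auto
    ultimately show False
      using assms by (simp add: \<psi>_def)
  qed
  \<comment> \<open>The closure was formed inside \<open>X_tilde n\<close>, so it is the trace of a
    closed set of the whole quotient, and \<open>?C\<close> lies in
    \<open>X_tilde n\<close>.\<close>
  moreover have "closedin (subtopology (G_times_B_b n) ?C) ?A"
  proof -
    obtain T where T: "closedin (G_times_B_b n) T" "X_tilde_cell n ?w = T \<inter> (X_tilde n :: 'k pt set)"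
      using closedin_closure_of[of "subtopology (G_times_B_b n) (X_tilde n)" "V_tilde n ?w :: 'k pt set"]
      unfolding X_tilde_cell_def closedin_subtopology by blast
    have "V_tilde n ?w' \<subseteq> (X_tilde n :: 'k pt set)"
      by (auto simp: V_tilde_def)
    then have "?A = T \<inter> ?C"
      using sub T(2) by blast
    then show ?thesis
      using T(1) unfolding closedin_subtopology by blast
  qed
  ultimately have "dim_of n ?A < dim_of n ?C"
    using irreducible_V_tilde_Int_q_preimage[OF w' v] by (intro dim_of_less)
  then show ?thesis
    using w w' le bad \<open>?A \<noteq> ?C\<close> by (metis Int_commute)
qed

end
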